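(* Let $\mathcal{H}$ be a real separable Hilbert space and let $X=\{X(h):h\in\mathcal{H}\}$ be an isonormal Gaussian process over $\mathcal{H}$. Let $d\ge 2$, let $k_1,\dots,k_d\ge 1$ be integers and, for $i=1,\dots,d$, let $f_i\in\mathcal{H}^{\odot k_i}$. Then $$E\big[I_{k_1}(f_1)^2\cdots I_{k_d}(f_d)^2\big]\ \ge\ \prod_{i=1}^d E\big[I_{k_i}(f_i)^2\big]=\prod_{i=1}^d k_i!\,\|f_i\|^2_{\mathcal{H}^{\otimes k_i}}.$$
   Context: An isonormal Gaussian process over $\mathcal{H}$ is a centered Gaussian family $X=\{X(h):h\in\mathcal{H}\}$ indexed by $\mathcal{H}$ with $E[X(h)X(h')]=\langle h,h'\rangle_{\mathcal{H}}$ for all $h,h'\in\mathcal{H}$. $\mathcal{H}^{\otimes k}$ denotes the $k$th Hilbert tensor product of $\mathcal{H}$ and $\mathcal{H}^{\odot k}$ its $k$th symmetric tensor product (the subspace of symmetric tensors). $I_k$ denotes the multiple Wiener-It\^o integral of order $k$ with respect to $X$, with the normalization $E[I_k(f)^2]=k!\,\|f\|^2_{\mathcal{H}^{\otimes k}}$ for $f\in\mathcal{H}^{\odot k}$; equivalently, $I_k$ is the continuous linear map on $\mathcal{H}^{\odot k}$ with $I_k(h^{\otimes k})=H_k(X(h))$ for every $h\in\mathcal{H}$ with $\|h\|_{\mathcal{H}}=1$, where the Hermite polynomials are given by $H_0\equiv1$, $H_{k+1}(x)=xH_k(x)-H_k'(x)$. The image $\{I_k(f):f\in\mathcal{H}^{\odot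 k}\}$ is the $k$th Wiener chaos associated with $X$. *)

theory Defs
  imports
    "HOL-Probability.Probability"
    "HOL-Computational_Algebra.Polynomial"
    "HOL-Combinatorics.Permutations"
begin

subsection \<open>Isonormal Gaussian processes\<close>

text \<open>The second alternative is the degenerate case of variance zero.\<close>

definition gaussian_rv :: "'a measure \<Rightarrow> ('a \<Rightarrow> real) \<Rightarrow> bool" where
  "gaussian_rv M Y \<longleftrightarrow>
     (\<exists>\<mu> \<sigma>. \<sigma> > 0 \<and> distributed M lborel Y (normal_density \<mu> \<sigma>)) \<or>
     (Y \<in> borel_measurable M \<and> (\<exists>\<mu>. AE \<omega> in M. Y \<omega> = \<mu>))"

text \<open>A Gaussian family is one all of whose finite linear combinations are Gaussian.\<close>

locale isonormal_gaussian_process = prob_space M for M :: "'a measure" +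
  fixes X :: "'h::{real_inner, complete_space} \<Rightarrow> 'a \<Rightarrow> real"
  assumes gaussian: "finite S \<Longrightarrow> gaussian_rv M (\<lambda>\<omega>. \<Sum>h\<in>S. c h * X h \<omega>)"
    and centered: "expectation (X h) = 0"
    and covariance: "expectation (\<lambda>\<omega>. X h \<omega> * X h' \<omega>) = inner h h'"

subsection \<open>Hilbert tensor powers\<close>

text \<open>
  The Hilbert tensor power of order \<open>k\<close> of a real Hilbert space is realised as the space of
  Hilbert-Schmidt \<open>k\<close>-linear functionals; the elementary tensor of \<open>x\<^sub>1, \<dots>, x\<^sub>k\<close> is the functional
  mapping \<open>y\<^sub>1, \<dots>, y\<^sub>k\<close> to the product of the inner products of \<open>x\<^sub>i\<close> and \<open>y\<^sub>i\<close>.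
  A functional takes its \<open>k\<close> arguments as a list, and is \<open>0\<close> by convention on lists of any other
  length. In terms of an orthonormal basis \<open>E\<close>, the squared norm of \<open>t\<close> is the sum of
  \<open>t(e\<^sub>1, \<dots>, e\<^sub>k)\<^sup>2\<close> over all \<open>k\<close>-tuples from \<open>E\<close>. This sum does not depend on \<open>E\<close>, and is the
  supremum of the corresponding sums over finite orthonormal sets, which is how it is defined here.
\<close>

type_synonym 'h tensor = "'h list \<Rightarrow> real"

definition multilinear :: "nat \<Rightarrow> 'h::real_inner tensor \<Rightarrow> bool" where
  "multilinear k t \<longleftrightarrow> (\<forall>xs i. length xs = k \<and> i < k \<longrightarrow> linear (\<lambda>x. t (xs[i := x])))"

definition finite_orthonormal :: "'h::real_inner set \<Rightarrow> bool" where
  "finite_orthonormal B \<longleftrightarrow> finite B \<and> pairwise orthogonal B \<and> (\<forall>b\<in>B. norm b = 1)"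

definition hs_sum :: "nat \<Rightarrow> 'h::real_inner tensor \<Rightarrow> 'h set \<Rightarrow> real" where
  "hs_sum k t B = (\<Sum>bs | set bs \<subseteq> B \<and> length bs = k. (t bs)\<^sup>2)"

definition tensor_space :: "nat \<Rightarrow> 'h::{real_inner, complete_space} tensor set" where
  "tensor_space k = {t. multilinear k t \<and> (\<forall>xs. length xs \<noteq> k \<longrightarrow> t xs = 0) \<and>
     bdd_above (hs_sum k t ` Collect finite_orthonormal)}"

definition tensor_norm :: "nat \<Rightarrow> 'h::{real_inner, complete_space} tensor \<Rightarrow> real" where
  "tensor_norm k t = sqrt (SUP B \<in> Collect finite_orthonormal. hs_sum k t B)"

definition sym_tensor_space :: "nat \<Rightarrow> 'h::{real_inner, complete_space} tensor set" where
  "sym_tensor_space k = {t \<in> tensor_space k.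
     \<forall>xs \<pi>. length xs = k \<and> \<pi> permutes {..<k} \<longrightarrow> t (permute_list \<pi> xs) = t xs}"

definition tensor_pow :: "nat \<Rightarrow> 'h::real_inner \<Rightarrow> 'h tensor" where
  "tensor_pow k h = (\<lambda>xs. if length xs = k then \<Prod>x\<leftarrow>xs. inner h x else 0)"

subsection \<open>Multiple Wiener-Ito integrals\<close>

fun hermite :: "nat \<Rightarrow> real poly" where
  "hermite 0 = 1"
| "hermite (Suc k) = [:0, 1:] * hermite k - pderiv (hermite k)"

text \<open>
  \<open>I\<close> is the multiple Wiener-Ito integral of order \<open>k\<close> with respect to \<open>X\<close>: the continuous linear
  map from the symmetric tensors to \<open>L\<^sup>2\<close> that maps the \<open>k\<close>-th tensor power of a unit vector \<open>h\<close> to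
  the \<open>k\<close>-th Hermite polynomial of \<open>X h\<close>. As elements of \<open>L\<^sup>2\<close> are represented by functions,
  all equations hold almost surely, and \<open>I\<close> is determined up to the choice of versions.
\<close>

definition multiple_integral ::
  "'a measure \<Rightarrow> ('h::{real_inner, complete_space} \<Rightarrow> 'a \<Rightarrow> real) \<Rightarrow> nat \<Rightarrow>
    ('h tensor \<Rightarrow> 'a \<Rightarrow> real) \<Rightarrow> bool" where
  "multiple_integral M X k I \<longleftrightarrow>
     (\<forall>f\<in>sym_tensor_space k. I f \<in> borel_measurable M \<and> integrable M (\<lambda>\<omega>. (I f \<omega>)\<^sup>2)) \<and>
     (\<forall>f\<in>sym_tensor_space k. \<forall>g\<in>sym_tensor_space k. \<forall>a b.
        AE \<omega> in M. I (\<lambda>xs. a * f xs + b * g xs) \<omega> = a * I f \<omega> + b * I g \<omega>) \<and>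
     (\<exists>C. \<forall>f\<in>sym_tensor_space k. (\<integral>\<omega>. (I f \<omega>)\<^sup>2 \<partial>M) \<le> C * (tensor_norm k f)\<^sup>2) \<and>
     (\<forall>h. norm h = 1 \<longrightarrow> (AE \<omega> in M. I (tensor_pow k h) \<omega> = poly (hermite k) (X h \<omega>)))"

end

theory Submission
  imports Defs
begin

text \<open>
  Suppose first that all tensors have finite rank. Then the multiple integrals are polynomials
  \<open>F\<^sub>i\<close> of degree \<open>k\<^sub>i\<close> in finitely many independent standard normal variables. The second moment of
  any polynomial \<open>P\<close> is the sum of the second moments of its chaos components (theorem
  \<open>chaos_decomposition\<close>, which follows from Gaussian integration by parts), and is therefore at least
  that of its component of top degree, which is the Fischer norm of the leading homogeneous part of
  \<open>P\<close>. The leading part of a product is the product of the leading parts, and Bombieri's inequality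
  states that the Fischer norm is supermultiplicative (theorem \<open>bombieri_inequality\<close>): in the
  Leibniz expansion of the norm of a product, all cross terms are nonnegative. Since \<open>F\<^sub>i\<close> lies in a
  single chaos, the Fischer norm of its leading part equals its second moment. Chaining these facts
  proves the inequality in finite rank (lemma \<open>finite_rank_product\<close>).

  A general symmetric tensor is approximated by its compressions to finite-dimensional subspaces.
  Their multiple integrals converge in \<open>L\<^sup>2\<close>, but this alone does not allow passing to the limit in
  the mean of the product, nor does it show that the product is integrable. Both follow from a bound
  on the moments of polynomials of fixed degree that does not depend on the dimension (theorem
  \<open>second_moment_product\<close>): by the chaos decomposition it suffices to bound the means of the iterated
  derivatives of a product, which the Leibniz rule and the Cauchy-Schwarz inequality reduce to the
  second moments of the derivatives of the factors.

  Polynomials are treated as functions on the Hilbert space itself, with directional derivatives,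
  which are evaluated at the random vector \<open>gvec B\<close> in the span of a finite orthonormal set \<open>B\<close>.
  Polarization reduces linear statements to powers: of linear forms for polynomials, and of vectors
  for symmetric tensors. Powers are all that is needed to derive integration by parts from the
  one-dimensional normal moments, and to evaluate multiple integrals from their values on powers of
  unit vectors.
\<close>

section \<open>Polarization\<close>

lemma sum_over_supersets_alternating:
  assumes "finite N" "T \<subseteq> N"
  shows "(\<Sum>S | T \<subseteq> S \<and> S \<subseteq> N. (-1) ^ card (N - S)) = (if T = N then 1 else 0 :: real)"
proof -
  have "(\<Sum>S | T \<subseteq> S \<and> S \<subseteq> N. (-1) ^ card (N - S)) = (\<Sum>U\<in>Pow (N - T). (-1::real) ^ card U)"
    using assms
    by (intro sum.reindex_bij_witness[where i = "\<lambda>U. N - U" and j = "\<lambda>S. N - S"])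
       (auto simp: double_diff)
  also have "\<dots> = (\<Prod>x\<in>N - T. (-1) + 1)"
    using prod_add[of "N - T" "\<lambda>_. -1::real" "\<lambda>_. 1"] assms by simp
  also have "\<dots> = (if T = N then 1 else 0)"
    using assms by (auto simp: power_0_left)
  finally show ?thesis .
qed

text \<open>
  Ryser's formula for the permanent of a matrix \<open>a\<close>. It holds because expanding the products
  yields one term for each map \<open>g\<close> from the index set into \<open>S\<close>, and the alternating sum over \<open>S\<close>
  cancels every \<open>g\<close> that is not onto the index set. In this development it plays the role of the
  polarization identity: it expresses a product of \<open>n\<close> linear forms, or a symmetrized elementary
  tensor, by \<open>n\<close>-th powers.
\<close>

lemma ryser_permanent:
  fixes a :: "nat \<Rightarrow> nat \<Rightarrow> real"
  shows "(\<Sum>S\<in>Pow {..<n}. (-1) ^ card ({..<n} - S) * (\<Prod>i<n. \<Sum>j\<in>S. a j i)) =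
    (\<Sum>\<pi> | \<pi> permutes {..<n}. \<Prod>i<n. a (\<pi> i) i)"
proof -
  let ?N = "{..<n}" and ?F = "PiE {..<n} (\<lambda>_. {..<n})"
  have fin: "finite ?F" by (simp add: finite_PiE)
  have "(\<Sum>S\<in>Pow ?N. (-1) ^ card (?N - S) * (\<Prod>i<n. \<Sum>j\<in>S. a j i)) =
      (\<Sum>S\<in>Pow ?N. \<Sum>g\<in>?F. if g ` ?N \<subseteq> S then (-1) ^ card (?N - S) * (\<Prod>i<n. a (g i) i) else 0)"
  proof (rule sum.cong[OF refl])
    fix S assume S: "S \<in> Pow ?N"
    then have "finite S" by (auto intro: finite_subset)
    then have "(\<Prod>i<n. \<Sum>j\<in>S. a j i) = (\<Sum>g\<in>PiE ?N (\<lambda>_. S). \<Prod>i<n. a (g i) i)"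
      by (intro prod_sum_PiE) auto
    also have "PiE ?N (\<lambda>_. S) = {g\<in>?F. g ` ?N \<subseteq> S}"
      using S by (auto simp: PiE_def Pi_def)
    also have "(\<Sum>g\<in>{g\<in>?F. g ` ?N \<subseteq> S}. \<Prod>i<n. a (g i) i) =
        (\<Sum>g\<in>?F. if g ` ?N \<subseteq> S then (\<Prod>i<n. a (g i) i) else 0)"
      using fin by (simp add: sum.inter_filter)
    finally show "(-1) ^ card (?N - S) * (\<Prod>i<n. \<Sum>j\<in>S. a j i) =
        (\<Sum>g\<in>?F. if g ` ?N \<subseteq> S then (-1) ^ card (?N - S) * (\<Prod>i<n. a (g i) i) else 0)"
      by (simp add: sum_distrib_left if_distrib cong: if_cong)
  qed
  also have "\<dots> = (\<Sum>g\<in>?F. \<Sum>S\<in>Pow ?N. if g ` ?N \<subseteq> S then (-1) ^ card (?N - S) * (\<Prod>i<n. a (g i) i) else 0)"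
    by (rule sum.swap)
  also have "\<dots> = (\<Sum>g\<in>?F. if g ` ?N = ?N then (\<Prod>i<n. a (g i) i) else 0)"
  proof (rule sum.cong[OF refl])
    fix g assume g: "g \<in> ?F"
    have "(\<Sum>S\<in>Pow ?N. if g ` ?N \<subseteq> S then (-1) ^ card (?N - S) * (\<Prod>i<n. a (g i) i) else 0)
       = (\<Sum>S\<in>{S\<in>Pow ?N. g ` ?N \<subseteq> S}. (-1) ^ card (?N - S) * (\<Prod>i<n. a (g i) i))"
      by (subst sum.inter_filter) auto
    also have "{S\<in>Pow ?N. g ` ?N \<subseteq> S} = {S. g ` ?N \<subseteq> S \<and> S \<subseteq> ?N}" by auto
    also have "(\<Sum>S\<in>\<dots>. (-1) ^ card (?N - S) * (\<Prod>i<n. a (g i) i)) =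
        (if g ` ?N = ?N then (\<Prod>i<n. a (g i) i) else 0)"
    proof -
      have "g ` ?N \<subseteq> ?N" using g by auto
      then have "(\<Sum>S | g ` ?N \<subseteq> S \<and> S \<subseteq> ?N. (-1) ^ card (?N - S)) = (if g ` ?N = ?N then 1 else 0 :: real)"
        by (intro sum_over_supersets_alternating) auto
      then show ?thesis by (simp only: sum_distrib_right[symmetric]) simp
    qed
    finally show "(\<Sum>S\<in>Pow ?N. if g ` ?N \<subseteq> S then (-1) ^ card (?N - S) * (\<Prod>i<n. a (g i) i) else 0) =
       (if g ` ?N = ?N then (\<Prod>i<n. a (g i) i) else 0)" .
  qed
  also have "\<dots> = (\<Sum>g\<in>{g\<in>?F. g ` ?N = ?N}. \<Prod>i<n. a (g i) i)"
    using fin by (simp add: sum.inter_filter)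
  also have "\<dots> = (\<Sum>\<pi> | \<pi> permutes ?N. \<Prod>i<n. a (\<pi> i) i)"
  proof (rule sum.reindex_bij_witness[where j = "\<lambda>g x. if x \<in> ?N then g x else x" and i = "\<lambda>\<pi>. restrict \<pi> ?N"])
    fix g assume g: "g \<in> {g\<in>?F. g ` ?N = ?N}"
    show "restrict (\<lambda>x. if x \<in> ?N then g x else x) ?N = g"
      using g by (auto simp: PiE_def extensional_def restrict_def fun_eq_iff)
    have "inj_on g ?N" using g by (intro eq_card_imp_inj_on) auto
    then have "bij_betw g ?N ?N" using g by (auto simp: bij_betw_def)
    then have "bij_betw (\<lambda>x. if x \<in> ?N then g x else x) ?N ?N"
      by (rule iffD1[OF bij_betw_cong, rotated]) auto
    from bij_imp_permutes[OF this]
    show "(\<lambda>x. if x \<in> ?N then g x else x) \<in> {\<pi>. \<pi> permutes ?N}"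
      by auto
    show "(\<Prod>i<n. a (if i \<in> ?N then g i else i) i) = (\<Prod>i<n. a (g i) i)"
      by (intro prod.cong) auto
  next
    fix \<pi> assume \<pi>: "\<pi> \<in> {\<pi>. \<pi> permutes ?N}"
    then show "(\<lambda>x. if x \<in> ?N then restrict \<pi> ?N x else x) = \<pi>"
      by (auto simp: fun_eq_iff permutes_not_in)
    show "restrict \<pi> ?N \<in> {g\<in>?F. g ` ?N = ?N}"
      using \<pi> permutes_image[of \<pi> ?N] permutes_in_image[of \<pi> ?N] by auto
  qed
  finally show ?thesis .
qed

section \<open>Polynomial functions on an inner product space\<close>

text \<open>
  The polynomial functions of degree at most \<open>n\<close>. Powers of linear forms suffice as generators by
  polarization, and taking them as the generators makes linear statements about polynomials
  reducible to powers by induction.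
\<close>

inductive_set polyfun :: "nat \<Rightarrow> ('h::real_inner \<Rightarrow> real) set" for n where
  power: "m \<le> n \<Longrightarrow> (\<lambda>x. inner h x ^ m) \<in> polyfun n"
| add: "p \<in> polyfun n \<Longrightarrow> q \<in> polyfun n \<Longrightarrow> (\<lambda>x. p x + q x) \<in> polyfun n"
| scale: "p \<in> polyfun n \<Longrightarrow> (\<lambda>x. c * p x) \<in> polyfun n"

lemma polyfun_const [intro]: "(\<lambda>x. c) \<in> polyfun n"
  using polyfun.scale[OF polyfun.power[of 0 n undefined], of c] by simp

lemma polyfun_diff: "p \<in> polyfun n \<Longrightarrow> q \<in> polyfun n \<Longrightarrow> (\<lambda>x. p x - q x) \<in> polyfun n"
  using polyfun.add[of p n "\<lambda>x. (-1) * q x"] polyfun.scale[of q n "-1"] by simp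

lemma polyfun_sum:
  assumes "\<And>i. i \<in> A \<Longrightarrow> p i \<in> polyfun n"
  shows "(\<lambda>x. \<Sum>i\<in>A. p i x) \<in> polyfun n"
  using assms by (induction A rule: infinite_finite_induct) (auto intro: polyfun.add)

lemma polyfun_mono: "p \<in> polyfun n \<Longrightarrow> n \<le> m \<Longrightarrow> p \<in> polyfun m"
  by (induction rule: polyfun.induct) (auto intro: polyfun.intros)

lemma polyfun_power_mult_power:
  assumes "a + b \<le> n"
  shows "(\<lambda>x. inner g x ^ a * inner h x ^ b) \<in> polyfun n"
proof -
  define m where "m = a + b"
  \<comment> \<open>\<open>a\<close> copies of \<open>g\<close> and \<open>b\<close> copies of \<open>h\<close>, to be polarized\<close>
  define v where "v j = (if j < a then g else h)" for j
  have eq: "inner g x ^ a * inner h x ^ b =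
      (1 / fact m) * (\<Sum>S\<in>Pow {..<m}. (-1) ^ card ({..<m} - S) * inner (\<Sum>j\<in>S. v j) x ^ m)" for x
  proof -
    have "(\<Prod>i<m. inner (v i) x) = (\<Prod>i\<in>{..<a} \<union> {a..<m}. inner (v i) x)"
      by (rule prod.cong) (auto simp: m_def)
    also have "\<dots> = (\<Prod>i<a. inner (v i) x) * (\<Prod>i\<in>{a..<m}. inner (v i) x)"
      by (rule prod.union_disjoint) auto
    also have "\<dots> = inner g x ^ a * inner h x ^ b"
      by (simp add: v_def m_def)
    finally have prod: "(\<Prod>i<m. inner (v i) x) = inner g x ^ a * inner h x ^ b" .
    have "(\<Sum>S\<in>Pow {..<m}. (-1) ^ card ({..<m} - S) * inner (\<Sum>j\<in>S. v j) x ^ m) =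
        (\<Sum>S\<in>Pow {..<m}. (-1) ^ card ({..<m} - S) * (\<Prod>i<m. \<Sum>j\<in>S. inner (v j) x))"
      by (simp add: inner_sum_left)
    also have "\<dots> = (\<Sum>\<pi> | \<pi> permutes {..<m}. \<Prod>i<m. inner (v (\<pi> i)) x)"
      by (rule ryser_permanent)
    also have "\<dots> = (\<Sum>\<pi> | \<pi> permutes {..<m}. \<Prod>i<m. inner (v i) x)"
      by (intro sum.cong refl) (auto simp: prod.permute[of _ _ "\<lambda>i. inner (v i) x"] o_def)
    also have "\<dots> = fact m * (inner g x ^ a * inner h x ^ b)"
      by (simp add: prod card_permutations[of _ m])
    finally show ?thesis by simp
  qed
  show ?thesis unfolding eq
    using assms by (intro polyfun.scale polyfun_sum polyfun.power) (simp add: m_def)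
qed

lemma polyfun_mult:
  assumes "p \<in> polyfun n" "q \<in> polyfun m"
  shows "(\<lambda>x. p x * q x) \<in> polyfun (n + m)"
  using assms(1)
proof (induction rule: polyfun.induct)
  case (power a g)
  show ?case using assms(2)
  proof (induction rule: polyfun.induct)
    case (power b h)
    then show ?case using \<open>a \<le> n\<close> by (intro polyfun_power_mult_power) auto
  next
    case (add p q)
    then show ?case using polyfun.add[OF add.IH] by (simp add: algebra_simps)
  next
    case (scale p c)
    then show ?case using polyfun.scale[OF scale.IH, of c] by (simp add: algebra_simps)
  qed
next
  case (add p q)
  then show ?case using polyfun.add[OF add.IH] by (simp add: algebra_simps)
next
  case (scale p c)
  then show ?case using polyfun.scale[OF scale.IH, of c] by (simp add: algebra_simps)
qed

lemma polyfun_prod: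
  assumes "\<And>i. i \<in> A \<Longrightarrow> p i \<in> polyfun (k i)"
  shows "(\<lambda>x. \<Prod>i\<in>A. p i x) \<in> polyfun (\<Sum>i\<in>A. k i)"
  using assms by (induction A rule: infinite_finite_induct) (auto intro: polyfun_mult)

lemma polyfun_linear_mult: "p \<in> polyfun n \<Longrightarrow> (\<lambda>x. inner h x * p x) \<in> polyfun (Suc n)"
  using polyfun_mult[OF polyfun.power[of 1 1 h]] by simp

section \<open>Directional derivatives\<close>

definition dirD :: "'h::real_inner \<Rightarrow> ('h \<Rightarrow> real) \<Rightarrow> 'h \<Rightarrow> real" where
  "dirD b p x = deriv (\<lambda>t. p (x + t *\<^sub>R b)) 0"

lemma polyfun_line_differentiable:
  "p \<in> polyfun n \<Longrightarrow> ((\<lambda>t. p (x + t *\<^sub>R b)) has_real_derivative dirD b p x) (at 0)"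
proof -
  assume "p \<in> polyfun n"
  then have "\<exists>D. ((\<lambda>t. p (x + t *\<^sub>R b)) has_real_derivative D) (at 0)"
  proof (induction rule: polyfun.induct)
    case (power m h)
    have "((\<lambda>t. (inner h x + t * inner h b) ^ m) has_real_derivative
        real m * (inner h b) * (inner h x + 0 * inner h b) ^ (m - 1)) (at 0)"
      by (auto intro!: derivative_eq_intros)
    then show ?case by (auto simp: inner_add_right)
  next
    case (add p q)
    then show ?case by (auto intro: DERIV_add)
  next
    case (scale p c)
    then show ?case by (auto intro: DERIV_cmult)
  qed
  then show ?thesis unfolding dirD_def
    by (metis DERIV_imp_deriv)
qed

lemma dirD_eqI:
  "(\<And>x. ((\<lambda>t. p (x + t *\<^sub>R b)) has_real_derivative D x) (at 0)) \<Longrightarrow> dirD b p = D"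
  by (auto simp: dirD_def fun_eq_iff intro!: DERIV_imp_deriv)

lemma dirD_power: "dirD b (\<lambda>x. inner h x ^ m) = (\<lambda>x. (real m * inner h b) * inner h x ^ (m - 1))"
proof (rule dirD_eqI)
  fix x
  have "((\<lambda>t. (inner h x + t * inner h b) ^ m) has_real_derivative
      real m * (inner h b) * (inner h x + 0 * inner h b) ^ (m - 1)) (at 0)"
    by (auto intro!: derivative_eq_intros)
  then show "((\<lambda>t. inner h (x + t *\<^sub>R b) ^ m) has_real_derivative
      (real m * inner h b) * inner h x ^ (m - 1)) (at 0)"
    by (simp add: inner_add_right)
qed

lemma dirD_add:
  assumes "p \<in> polyfun n" "q \<in> polyfun m"
  shows "dirD b (\<lambda>x. p x + q x) = (\<lambda>x. dirD b p x + dirD b q x)"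
  using assms by (intro dirD_eqI DERIV_add polyfun_line_differentiable)

lemma dirD_scale:
  assumes "p \<in> polyfun n"
  shows "dirD b (\<lambda>x. c * p x) = (\<lambda>x. c * dirD b p x)"
  using assms by (intro dirD_eqI DERIV_cmult polyfun_line_differentiable)

lemma dirD_mult:
  assumes "p \<in> polyfun n" "q \<in> polyfun m"
  shows "dirD b (\<lambda>x. p x * q x) = (\<lambda>x. dirD b p x * q x + p x * dirD b q x)"
proof (rule dirD_eqI)
  fix x
  show "((\<lambda>t. p (x + t *\<^sub>R b) * q (x + t *\<^sub>R b)) has_real_derivative
      dirD b p x * q x + p x * dirD b q x) (at 0)"
    using DERIV_mult[OF polyfun_line_differentiable[OF assms(1), of x b]
      polyfun_line_differentiable[OF assms(2), of x b]] by (simp add: algebra_simps)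
qed

lemma dirD_const [simp]: "dirD b (\<lambda>x. c) = (\<lambda>x. 0)"
  by (intro dirD_eqI) simp

lemma dirD_polyfun: "p \<in> polyfun n \<Longrightarrow> dirD b p \<in> polyfun (n - 1)"
  by (induction rule: polyfun.induct)
    (auto simp: dirD_power dirD_add dirD_scale intro!: polyfun.intros)

lemma dirD_polyfun': "p \<in> polyfun n \<Longrightarrow> dirD b p \<in> polyfun n"
  by (rule polyfun_mono[OF dirD_polyfun]) auto

lemma polyfun_0_const: "p \<in> polyfun 0 \<Longrightarrow> \<exists>c. p = (\<lambda>x. c)"
proof (induction rule: polyfun.induct)
  case (power m h)
  then show ?case by (intro exI[of _ 1]) auto
next
  case (add p q)
  then show ?case by auto
next
  case (scale p c)
  then show ?case by auto
qed

lemma dirD_polyfun_0: "p \<in> polyfun 0 \<Longrightarrow> dirD b p = (\<lambda>x. 0)"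
  using polyfun_0_const[of p] by auto

lemma dirD_commute: "p \<in> polyfun n \<Longrightarrow> dirD a (dirD b p) = dirD b (dirD a p)"
proof (induction rule: polyfun.induct)
  case (power m h)
  have "dirD a (\<lambda>x. c * inner h x ^ m') = (\<lambda>x. c * ((real m' * inner h a) * inner h x ^ (m' - 1)))" for a c m'
    using dirD_scale[OF polyfun.power[of m' m' h], of a c] by (simp add: dirD_power)
  from this[of a "real m * inner h b" "m - 1"] this[of b "real m * inner h a" "m - 1"]
  show ?case by (simp add: dirD_power mult_ac)
next
  case (add p q)
  then show ?case by (simp add: dirD_add[where n = n and m = n] dirD_polyfun')
next
  case (scale p c)
  then show ?case by (simp add: dirD_scale[where n = n] dirD_polyfun')
qed

section \<open>Pairing polynomials through their derivatives\<close>

text \<open>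
  For an orthonormal set \<open>B\<close>, the pairing of order \<open>m\<close> is \<open>1/m!\<close> times the sum, over all
  \<open>m\<close>-tuples from \<open>B\<close>, of the products of \<open>L\<close> applied to the two iterated derivatives. For \<open>L\<close> the
  Gaussian expectation, this is the inner product of the projections to the chaos of order \<open>m\<close>.
\<close>

fun deriv_pairing ::
  "'h::real_inner set \<Rightarrow> (('h \<Rightarrow> real) \<Rightarrow> real) \<Rightarrow> nat \<Rightarrow> ('h \<Rightarrow> real) \<Rightarrow> ('h \<Rightarrow> real) \<Rightarrow> real" where
  "deriv_pairing B L 0 p q = L p * L q"
| "deriv_pairing B L (Suc m) p q =
     (\<Sum>b\<in>B. deriv_pairing B L m (dirD b p) (dirD b q)) / real (Suc m)"

lemma deriv_pairing_sym: "deriv_pairing B L m p q = deriv_pairing B L m q p"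
  by (induction m arbitrary: p q) (auto simp: mult.commute intro!: sum.cong)

lemma deriv_pairing_nonneg: "0 \<le> deriv_pairing B L m p p"
  by (induction m arbitrary: p) (auto intro!: divide_nonneg_nonneg sum_nonneg)

locale polyfun_functional =
  fixes B :: "'h::real_inner set" and L :: "('h \<Rightarrow> real) \<Rightarrow> real"
  assumes L_add: "p \<in> polyfun n \<Longrightarrow> q \<in> polyfun n \<Longrightarrow> L (\<lambda>x. p x + q x) = L p + L q"
    and L_scale: "p \<in> polyfun n \<Longrightarrow> L (\<lambda>x. c * p x) = c * L p"
    and L_one: "L (\<lambda>x. 1) = 1"
begin

lemma L_const [simp]: "L (\<lambda>x. c) = c"
  using L_scale[of "\<lambda>x. 1" 0 c] L_one by auto

lemma pairing_add_left:
  assumes "p \<in> polyfun n" "p' \<in> polyfun n"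
  shows "deriv_pairing B L m (\<lambda>x. p x + p' x) q = deriv_pairing B L m p q + deriv_pairing B L m p' q"
  using assms
proof (induction m arbitrary: p p' q)
  case 0
  then show ?case by (simp add: L_add[where n = n] algebra_simps)
next
  case (Suc m)
  then show ?case
    by (simp add: dirD_add[where n = n and m = n] dirD_polyfun' sum.distrib add_divide_distrib)
qed

lemma pairing_scale_left:
  assumes "p \<in> polyfun n"
  shows "deriv_pairing B L m (\<lambda>x. c * p x) q = c * deriv_pairing B L m p q"
  using assms
proof (induction m arbitrary: p q)
  case 0
  then show ?case by (simp add: L_scale[where n = n] algebra_simps)
next
  case (Suc m)
  then show ?case
    by (simp add: dirD_scale[where n = n] dirD_polyfun' sum_distrib_left)
qed

lemma pairing_zero_left [simp]: "deriv_pairing B L m (\<lambda>x. 0) q = 0"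
  using pairing_scale_left[of "\<lambda>x. 0" 0 m 0 q] by auto

lemma pairing_zero_right [simp]: "deriv_pairing B L m p (\<lambda>x. 0) = 0"
  by (simp add: deriv_pairing_sym[of _ _ _ p])

lemma pairing_add_right:
  assumes "q \<in> polyfun n" "q' \<in> polyfun n"
  shows "deriv_pairing B L m p (\<lambda>x. q x + q' x) = deriv_pairing B L m p q + deriv_pairing B L m p q'"
  using pairing_add_left[OF assms, of m p] by (simp add: deriv_pairing_sym[of _ _ _ p])

lemma pairing_square_add:
  assumes "p \<in> polyfun n" "q \<in> polyfun n"
  shows "deriv_pairing B L m (\<lambda>x. p x + q x) (\<lambda>x. p x + q x) =
    deriv_pairing B L m p p + deriv_pairing B L m q q + 2 * deriv_pairing B L m p q"
  using pairing_add_left[OF assms] pairing_add_right[OF assms] deriv_pairing_sym[of B L m q p]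
  by simp

lemma pairing_square_add_le:
  assumes "p \<in> polyfun n" "q \<in> polyfun n"
  shows "deriv_pairing B L m (\<lambda>x. p x + q x) (\<lambda>x. p x + q x) \<le>
    2 * (deriv_pairing B L m p p + deriv_pairing B L m q q)"
proof -
  have "deriv_pairing B L m (\<lambda>x. p x + (-1) * q x) (\<lambda>x. p x + (-1) * q x) =
      deriv_pairing B L m p p + deriv_pairing B L m q q - 2 * deriv_pairing B L m p q"
  proof -
    have q: "(\<lambda>x. (-1) * q x) \<in> polyfun n" using assms(2) by (rule polyfun.scale)
    have "deriv_pairing B L m p (\<lambda>x. (-1) * q x) = - deriv_pairing B L m p q"
      using pairing_scale_left[OF assms(2), of m "-1" p]
      by (simp only: deriv_pairing_sym[of B L m p "\<lambda>x. (-1) * q x"] deriv_pairing_sym[of B L m p q])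
    moreover have "deriv_pairing B L m (\<lambda>x. (-1) * q x) (\<lambda>x. (-1) * q x) = deriv_pairing B L m q q"
      using pairing_scale_left[OF assms(2), of m "-1" q] pairing_scale_left[OF assms(2), of m "-1" "\<lambda>x. (-1) * q x"]
      by (simp only: deriv_pairing_sym[of B L m q "\<lambda>x. (-1) * q x"])
    ultimately show ?thesis
      using pairing_square_add[OF assms(1) q, of m] by (simp only:)
  qed
  then show ?thesis
    using pairing_square_add[OF assms, of m] deriv_pairing_nonneg[of B L m "\<lambda>x. p x + (-1) * q x"]
    by simp
qed

lemma pairing_degree:
  assumes "p \<in> polyfun n" "n < m"
  shows "deriv_pairing B L m p q = 0"
  using assms
proof (induction m arbitrary: n p q)
  case (Suc m)
  show ?case
  proof (cases n)
    case 0
    then have "dirD b p = (\<lambda>x. 0)" for b using Suc.prems dirD_polyfun_0[of p b] by simp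
    then show ?thesis by simp
  next
    case (Suc n')
    have "deriv_pairing B L m (dirD b p) (dirD b q) = 0" for b
      using Suc.IH[of "dirD b p" n' "dirD b q"] dirD_polyfun[OF Suc.prems(1), of b] Suc Suc.prems(2) by simp
    then show ?thesis by simp
  qed
qed simp

end

text \<open>
  With evaluation at the origin as the functional, the pairing of order \<open>n\<close> of two polynomials of
  degree at most \<open>n\<close> is the Fischer (or Bombieri) inner product of their homogeneous parts of
  degree \<open>n\<close>.
\<close>

interpretation eval0: polyfun_functional B "\<lambda>p. p 0" for B :: "'h::real_inner set"
  by unfold_locales auto

lemma (in polyfun_functional) pairing_top_degree:
  assumes "p \<in> polyfun n" "q \<in> polyfun n"
  shows "deriv_pairing B L n p q = deriv_pairing B (\<lambda>p. p 0) n p q"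
  using assms
proof (induction n arbitrary: p q)
  case 0
  then obtain c d where "p = (\<lambda>x. c)" "q = (\<lambda>x. d)"
    using polyfun_0_const by metis
  then show ?case by simp
next
  case (Suc n)
  have "deriv_pairing B L n (dirD b p) (dirD b q) = deriv_pairing B (\<lambda>p. p 0) n (dirD b p) (dirD b q)" for b
    using Suc.IH[of "dirD b p" "dirD b q"] Suc.prems dirD_polyfun[of _ "Suc n" b] by simp
  then show ?case by simp
qed

section \<open>Bombieri's inequality\<close>

definition tuples :: "'h set \<Rightarrow> nat \<Rightarrow> 'h list set" where
  "tuples B k = {bs. set bs \<subseteq> B \<and> length bs = k}"

lemma finite_tuples: "finite B \<Longrightarrow> finite (tuples B k)"
  unfolding tuples_def by (rule finite_lists_length_eq)

lemma sum_tuples_0: "(\<Sum>bs\<in>tuples B 0. f bs) = f []"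
proof -
  have "tuples B 0 = {[]}" by (auto simp: tuples_def)
  then show ?thesis by simp
qed

lemma sum_tuples_Suc:
  assumes "finite B"
  shows "(\<Sum>bs\<in>tuples B (Suc k). f bs) = (\<Sum>b\<in>B. \<Sum>bs\<in>tuples B k. f (b # bs))"
proof -
  have "(\<Sum>bs\<in>tuples B (Suc k). f bs) = (\<Sum>(b, bs)\<in>B \<times> tuples B k. f (b # bs))"
    by (rule sum.reindex_bij_witness[where i = "\<lambda>(b, bs). b # bs" and j = "\<lambda>bs. (hd bs, tl bs)"])
       (auto simp: tuples_def length_Suc_conv)
  then show ?thesis using assms by (simp add: sum.cartesian_product finite_tuples)
qed

definition iterD :: "'h::real_inner list \<Rightarrow> ('h \<Rightarrow> real) \<Rightarrow> 'h \<Rightarrow> real" where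
  "iterD bs p = foldr dirD bs p"

lemma iterD_Nil [simp]: "iterD [] p = p"
  and iterD_Cons [simp]: "iterD (b # bs) p = dirD b (iterD bs p)"
  by (simp_all add: iterD_def)

lemma iterD_polyfun: "p \<in> polyfun n \<Longrightarrow> iterD bs p \<in> polyfun (n - length bs)"
proof (induction bs)
  case (Cons b bs)
  then show ?case using dirD_polyfun[of "iterD bs p" "n - length bs" b] by simp
qed simp

lemma iterD_polyfun': "p \<in> polyfun n \<Longrightarrow> iterD bs p \<in> polyfun n"
  by (rule polyfun_mono[OF iterD_polyfun]) auto

lemma iterD_zero [simp]: "iterD bs (\<lambda>x. 0) = (\<lambda>x. 0)"
  by (induction bs) auto

lemma iterD_dirD: "p \<in> polyfun n \<Longrightarrow> iterD bs (dirD c p) = dirD c (iterD bs p)"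
proof (induction bs)
  case (Cons b bs)
  then show ?case using dirD_commute[OF iterD_polyfun'[OF Cons.prems]] by simp
qed simp

lemma iterD_eq_0:
  assumes "p \<in> polyfun n" "n < length bs"
  shows "iterD bs p = (\<lambda>x. 0)"
proof -
  obtain b cs where bs: "bs = b # cs" using assms(2) by (cases bs) auto
  then have "iterD cs p \<in> polyfun 0"
    using iterD_polyfun[OF assms(1), of cs] assms(2) by simp
  then show ?thesis using bs dirD_polyfun_0 by simp
qed

text \<open>
  These sums are the cross terms that arise when the Fischer norm of a product is expanded by the
  Leibniz rule: in each of them, every derivative that acts on \<open>p\<close> on one side acts on \<open>q\<close> on the
  other. The pattern is reproduced when a further derivative is taken, and once all derivatives
  have been distributed the sum is zero or a square, by degree considerations. Hence all of them
  are nonnegative.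
\<close>

lemma leibniz_cross_terms_nonneg:
  fixes p q :: "'h::real_inner \<Rightarrow> real"
  assumes "finite B" "p \<in> polyfun n" "q \<in> polyfun m" "n + m = i + j + r"
  shows "0 \<le> (\<Sum>as\<in>tuples B i. \<Sum>bs\<in>tuples B j. deriv_pairing B (\<lambda>p. p 0) r
    (\<lambda>x. iterD as p x * iterD bs q x) (\<lambda>x. iterD bs p x * iterD as q x))"
  using assms(2-4)
proof (induction r arbitrary: i j n m p q)
  case 0
  show ?case
  proof (cases "i = j")
    case True
    have "(\<Sum>as\<in>tuples B i. \<Sum>bs\<in>tuples B j. deriv_pairing B (\<lambda>p. p 0) 0
      (\<lambda>x. iterD as p x * iterD bs q x) (\<lambda>x. iterD bs p x * iterD as q x)) =
      (\<Sum>as\<in>tuples B i. iterD as p 0 * iterD as q 0)\<^sup>2"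
      unfolding True power2_eq_square sum_product by (intro sum.cong refl) simp
    then show ?thesis by simp
  next
    case False
    then consider "n < i" | "m < i" | "n < j" | "m < j" using 0 by linarith
    then have zero: "deriv_pairing B (\<lambda>p. p 0) 0 (\<lambda>x. iterD as p x * iterD bs q x)
        (\<lambda>x. iterD bs p x * iterD as q x) = 0" if "as \<in> tuples B i" "bs \<in> tuples B j" for as bs
      using that 0 iterD_eq_0[of p n] iterD_eq_0[of q m] by cases (auto simp: tuples_def)
    show ?thesis by (intro sum_nonneg) (simp only: zero order_refl)
  qed
next
  case (Suc r)
  define \<Phi> where "\<Phi> i j p q = (\<Sum>as\<in>tuples B i. \<Sum>bs\<in>tuples B j. deriv_pairing B (\<lambda>p. p 0) r
    (\<lambda>x. iterD as p x * iterD bs q x) (\<lambda>x. iterD bs p x * iterD as q x))" for i j and p q :: "'h \<Rightarrow> real"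
  let ?G = "deriv_pairing B (\<lambda>p. p 0) r"
  note p = iterD_polyfun'[OF Suc.prems(1)] and q = iterD_polyfun'[OF Suc.prems(2)]
  have split: "?G (dirD c (\<lambda>x. iterD as p x * iterD bs q x)) (dirD c (\<lambda>x. iterD bs p x * iterD as q x)) =
      ?G (\<lambda>x. iterD as (dirD c p) x * iterD bs q x) (\<lambda>x. iterD bs (dirD c p) x * iterD as q x)
    + ?G (\<lambda>x. iterD as p x * iterD bs (dirD c q) x) (\<lambda>x. iterD bs p x * iterD as (dirD c q) x)
    + ?G (\<lambda>x. iterD (c # as) p x * iterD bs q x) (\<lambda>x. iterD bs p x * iterD (c # as) q x)
    + ?G (\<lambda>x. iterD as p x * iterD (c # bs) q x) (\<lambda>x. iterD (c # bs) p x * iterD as q x)"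
    for c as bs
  proof -
    have pq: "(\<lambda>x. u x * v x) \<in> polyfun (n + m)" if "u \<in> polyfun n" "v \<in> polyfun m" for u v :: "'h \<Rightarrow> real"
      using that by (rule polyfun_mult)
    show ?thesis
      by (simp add: dirD_mult[OF p q] iterD_dirD[OF Suc.prems(1)] iterD_dirD[OF Suc.prems(2)]
          eval0.pairing_add_left[where n = "n + m"] eval0.pairing_add_right[where n = "n + m"]
          pq polyfun.add p q dirD_polyfun')
  qed
  have "real (Suc r) * (\<Sum>as\<in>tuples B i. \<Sum>bs\<in>tuples B j. deriv_pairing B (\<lambda>p. p 0) (Suc r)
      (\<lambda>x. iterD as p x * iterD bs q x) (\<lambda>x. iterD bs p x * iterD as q x)) =
    (\<Sum>as\<in>tuples B i. \<Sum>bs\<in>tuples B j. \<Sum>c\<in>B.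
      ?G (dirD c (\<lambda>x. iterD as p x * iterD bs q x)) (dirD c (\<lambda>x. iterD bs p x * iterD as q x)))"
    by (simp add: sum_divide_distrib[symmetric] del: of_nat_Suc)
  also have "\<dots> = (\<Sum>c\<in>B. \<Sum>as\<in>tuples B i. \<Sum>bs\<in>tuples B j. 
      ?G (dirD c (\<lambda>x. iterD as p x * iterD bs q x)) (dirD c (\<lambda>x. iterD bs p x * iterD as q x)))"
    by (rule trans[OF sum.cong[OF refl sum.swap] sum.swap])
  also have "\<dots> = (\<Sum>c\<in>B. \<Phi> i j (dirD c p) q) + (\<Sum>c\<in>B. \<Phi> i j p (dirD c q)) +
      \<Phi> (Suc i) j p q + \<Phi> i (Suc j) p q"
  proof -
    have "\<Phi> i (Suc j) p q = (\<Sum>c\<in>B. \<Sum>as\<in>tuples B i. \<Sum>bs\<in>tuples B j.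
       ?G (\<lambda>x. iterD as p x * iterD (c # bs) q x) (\<lambda>x. iterD (c # bs) p x * iterD as q x))"
      unfolding \<Phi>_def sum_tuples_Suc[OF assms(1)] by (rule sum.swap)
    moreover have "\<Phi> (Suc i) j p q = (\<Sum>c\<in>B. \<Sum>as\<in>tuples B i. \<Sum>bs\<in>tuples B j.
       ?G (\<lambda>x. iterD (c # as) p x * iterD bs q x) (\<lambda>x. iterD bs p x * iterD (c # as) q x))"
      unfolding \<Phi>_def sum_tuples_Suc[OF assms(1)] ..
    ultimately show ?thesis unfolding split \<Phi>_def by (simp only: sum.distrib)
  qed
  also have "\<dots> \<ge> 0"
  proof -
    have "0 \<le> \<Phi> i j (dirD c p) q" for c
    proof (cases n)
      case 0
      then have "dirD c p = (\<lambda>x. 0)" using Suc.prems dirD_polyfun_0 by simp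
      then show ?thesis unfolding \<Phi>_def by simp
    next
      case (Suc n')
      then show ?thesis unfolding \<Phi>_def
        using Suc.IH[of "dirD c p" n' q m i j] dirD_polyfun[OF Suc.prems(1), of c] Suc.prems by simp
    qed
    moreover have "0 \<le> \<Phi> i j p (dirD c q)" for c
    proof (cases m)
      case 0
      then have "dirD c q = (\<lambda>x. 0)" using Suc.prems dirD_polyfun_0 by simp
      then show ?thesis unfolding \<Phi>_def by simp
    next
      case (Suc m')
      then show ?thesis unfolding \<Phi>_def
        using Suc.IH[of p n "dirD c q" m' i j] dirD_polyfun[OF Suc.prems(2), of c] Suc.prems by simp
    qed
    moreover have "0 \<le> \<Phi> (Suc i) j p q" "0 \<le> \<Phi> i (Suc j) p q"
      unfolding \<Phi>_def using Suc.IH[OF Suc.prems(1,2)] Suc.prems(3) by auto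
    ultimately show ?thesis by (intro add_nonneg_nonneg sum_nonneg) auto
  qed
  finally show ?case by (simp add: zero_le_mult_iff)
qed

text \<open>
  Bombieri's inequality. By the Leibniz rule, the norm of the derivative of \<open>p q\<close> consists of the
  norms of the two summands, to which the induction hypothesis applies, and a cross term.
\<close>

theorem bombieri_inequality:
  fixes p q :: "'h::real_inner \<Rightarrow> real"
  assumes "finite B" "p \<in> polyfun n" "q \<in> polyfun m"
  shows "deriv_pairing B (\<lambda>p. p 0) n p p * deriv_pairing B (\<lambda>p. p 0) m q q \<le>
    deriv_pairing B (\<lambda>p. p 0) (n + m) (\<lambda>x. p x * q x) (\<lambda>x. p x * q x)"
  using assms(2,3)
proof (induction "n + m" arbitrary: n m p q)
  case 0
  then show ?case by (simp add: mult_ac)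
next
  case (Suc r)
  let ?F = "deriv_pairing B (\<lambda>p::'h \<Rightarrow> real. p 0)"
  note p = Suc.prems(1) and q = Suc.prems(2)
  have left: "real n * (?F n p p * ?F m q q) \<le> (\<Sum>b\<in>B. ?F r (\<lambda>x. dirD b p x * q x) (\<lambda>x. dirD b p x * q x))"
  proof (cases n)
    case 0
    then show ?thesis by (simp add: sum_nonneg deriv_pairing_nonneg)
  next
    case n: (Suc n')
    have "real n * (?F n p p * ?F m q q) = (\<Sum>b\<in>B. ?F n' (dirD b p) (dirD b p) * ?F m q q)"
      by (simp add: n sum_distrib_right del: of_nat_Suc)
    also have "\<dots> \<le> (\<Sum>b\<in>B. ?F r (\<lambda>x. dirD b p x * q x) (\<lambda>x. dirD b p x * q x))"
    proof (rule sum_mono)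
      fix b
      have r: "r = n' + m" using Suc(2) n by simp
      show "?F n' (dirD b p) (dirD b p) * ?F m q q \<le> ?F r (\<lambda>x. dirD b p x * q x) (\<lambda>x. dirD b p x * q x)"
        unfolding r using Suc(1)[OF r _ q, of "dirD b p"] dirD_polyfun[OF p, of b] n by simp
    qed
    finally show ?thesis .
  qed
  have right: "real m * (?F n p p * ?F m q q) \<le> (\<Sum>b\<in>B. ?F r (\<lambda>x. p x * dirD b q x) (\<lambda>x. p x * dirD b q x))"
  proof (cases m)
    case 0
    then show ?thesis by (simp add: sum_nonneg deriv_pairing_nonneg)
  next
    case m: (Suc m')
    have "real m * (?F n p p * ?F m q q) = (\<Sum>b\<in>B. ?F n p p * ?F m' (dirD b q) (dirD b q))"
      by (simp add: m sum_distrib_left[symmetric] del: of_nat_Suc)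
    also have "\<dots> \<le> (\<Sum>b\<in>B. ?F r (\<lambda>x. p x * dirD b q x) (\<lambda>x. p x * dirD b q x))"
    proof (rule sum_mono)
      fix b
      have r: "r = n + m'" using Suc(2) m by simp
      show "?F n p p * ?F m' (dirD b q) (dirD b q) \<le> ?F r (\<lambda>x. p x * dirD b q x) (\<lambda>x. p x * dirD b q x)"
        unfolding r using Suc(1)[OF r p, of "dirD b q"] dirD_polyfun[OF q, of b] m by simp
    qed
    finally show ?thesis .
  qed
  have cross: "0 \<le> (\<Sum>b\<in>B. ?F r (\<lambda>x. dirD b p x * q x) (\<lambda>x. p x * dirD b q x))"
    using leibniz_cross_terms_nonneg[OF assms(1) p q, of 1 0 r] Suc(2)
    by (simp add: sum_tuples_Suc[OF assms(1)] sum_tuples_0)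
  have "real (Suc r) * (?F n p p * ?F m q q) =
      real n * (?F n p p * ?F m q q) + real m * (?F n p p * ?F m q q)"
    unfolding Suc(2) by (simp add: algebra_simps)
  also have "\<dots> \<le> (\<Sum>b\<in>B. ?F r (\<lambda>x. dirD b p x * q x) (\<lambda>x. dirD b p x * q x)) +
      (\<Sum>b\<in>B. ?F r (\<lambda>x. p x * dirD b q x) (\<lambda>x. p x * dirD b q x)) +
      2 * (\<Sum>b\<in>B. ?F r (\<lambda>x. dirD b p x * q x) (\<lambda>x. p x * dirD b q x))"
    using left right cross by linarith
  also have "\<dots> = (\<Sum>b\<in>B. ?F r (dirD b (\<lambda>x. p x * q x)) (dirD b (\<lambda>x. p x * q x)))"
    unfolding dirD_mult[OF p q]
    by (subst eval0.pairing_square_add[where n = "n + m"])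
       (auto simp: sum.distrib sum_distrib_left intro!: polyfun_mult dirD_polyfun' p q)
  also have "\<dots> = real (Suc r) * ?F (n + m) (\<lambda>x. p x * q x) (\<lambda>x. p x * q x)"
    by (simp add: Suc(2)[symmetric] del: of_nat_Suc)
  finally show ?case by (simp del: of_nat_Suc add: mult_le_cancel_left_pos)
qed

lemma bombieri_inequality_prod:
  fixes p :: "'i \<Rightarrow> 'h::real_inner \<Rightarrow> real"
  assumes "finite B" "finite A" "\<And>i. i \<in> A \<Longrightarrow> p i \<in> polyfun (k i)"
  shows "(\<Prod>i\<in>A. deriv_pairing B (\<lambda>p. p 0) (k i) (p i) (p i)) \<le>
    deriv_pairing B (\<lambda>p. p 0) (\<Sum>i\<in>A. k i) (\<lambda>x. \<Prod>i\<in>A. p i x) (\<lambda>x. \<Prod>i\<in>A. p i x)"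
  using assms(2,3)
proof (induction A rule: finite_induct)
  case (insert i A)
  let ?F = "deriv_pairing B (\<lambda>p::'h \<Rightarrow> real. p 0)"
  have "(\<Prod>i\<in>insert i A. ?F (k i) (p i) (p i)) = ?F (k i) (p i) (p i) * (\<Prod>i\<in>A. ?F (k i) (p i) (p i))"
    using insert by simp
  also have "\<dots> \<le> ?F (k i) (p i) (p i) * ?F (\<Sum>i\<in>A. k i) (\<lambda>x. \<Prod>i\<in>A. p i x) (\<lambda>x. \<Prod>i\<in>A. p i x)"
    by (intro mult_left_mono deriv_pairing_nonneg insert.IH insert.prems) auto
  also have "\<dots> \<le> ?F (k i + (\<Sum>i\<in>A. k i)) (\<lambda>x. p i x * (\<Prod>i\<in>A. p i x)) (\<lambda>x. p i x * (\<Prod>i\<in>A. p i x))"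
    by (intro bombieri_inequality assms(1) polyfun_prod insert.prems) auto
  finally show ?case using insert by simp
qed simp

section \<open>Hermite polynomials of arbitrary variance\<close>

text \<open>
  The Hermite polynomials that are orthogonal for the centered normal law of variance \<open>s\<close>. For
  \<open>k = 0\<close> the truncated index \<open>k - 1\<close> in the recursion is harmless because of the factor \<open>k\<close>.
\<close>

fun hermite_var :: "real \<Rightarrow> nat \<Rightarrow> real \<Rightarrow> real" where
  "hermite_var s 0 y = 1"
| "hermite_var s (Suc k) y = y * hermite_var s k y - real k * s * hermite_var s (k - 1) y"

lemma hermite_var_deriv:
  "(hermite_var s k has_real_derivative real k * hermite_var s (k - 1) y) (at y)"
proof (induction s k y rule: hermite_var.induct)
  case (2 s k y)
  have "((\<lambda>y. y * hermite_var s k y - real k * s * hermite_var s (k - 1) y) has_real_derivative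
      (1 * hermite_var s k y + real k * hermite_var s (k - 1) y * y)
      - real k * s * (real (k - 1) * hermite_var s (k - 1 - 1) y)) (at y)"
    by (intro DERIV_diff DERIV_mult DERIV_cmult DERIV_ident 2)
  also have "(1 * hermite_var s k y + real k * hermite_var s (k - 1) y * y)
      - real k * s * (real (k - 1) * hermite_var s (k - 1 - 1) y) = real (Suc k) * hermite_var s k y"
  proof (cases k)
    case (Suc j)
    then show ?thesis by (cases j) (simp_all add: algebra_simps)
  qed simp
  finally show ?case by (simp add: fun_eq_iff)
qed simp

lemma hermite_var_polyfun: "(\<lambda>x. hermite_var s k (inner h x)) \<in> polyfun k"
proof (induction k rule: less_induct)
  case (less k)
  show ?case
  proof (cases k)
    case 0
    then show ?thesis by auto
  next
    case (Suc j)
    have "(\<lambda>x. inner h x * hermite_var s j (inner h x)) \<in> polyfun (Suc j)"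
      using less[of j] Suc by (intro polyfun_linear_mult) auto
    moreover have "(\<lambda>x. real j * s * hermite_var s (j - 1) (inner h x)) \<in> polyfun (Suc j)"
      using polyfun_mono[OF less[of "j - 1"], of "Suc j"] Suc by (intro polyfun.scale) auto
    ultimately show ?thesis using polyfun_diff Suc by auto
  qed
qed

lemma dirD_hermite_var: "dirD b (\<lambda>x. hermite_var s k (inner h x)) =
  (\<lambda>x. (real k * inner h b) * hermite_var s (k - 1) (inner h x))"
proof (rule dirD_eqI)
  fix x
  have "((\<lambda>t. hermite_var s k (inner h x + t * inner h b)) has_real_derivative
      real k * hermite_var s (k - 1) (inner h x + 0 * inner h b) * inner h b) (at 0)"
    by (rule DERIV_chain2[OF hermite_var_deriv]) (auto intro!: derivative_eq_intros)
  then show "((\<lambda>t. hermite_var s k (inner h (x + t *\<^sub>R b))) has_real_derivative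
      (real k * inner h b) * hermite_var s (k - 1) (inner h x)) (at 0)"
    by (simp add: inner_add_right mult_ac)
qed

section \<open>Gaussian expectations of polynomials\<close>

text \<open>
  The functional \<open>L\<close> is the expectation of a polynomial at a standard Gaussian vector in the span
  of \<open>B\<close>. Apart from positivity, the Gaussian law enters only through integration by parts.
\<close>

locale gaussian_functional = polyfun_functional +
  assumes finite_B: "finite B"
    and L_square_nonneg: "p \<in> polyfun n \<Longrightarrow> 0 \<le> L (\<lambda>x. p x * p x)"
    and integration_by_parts:
      "p \<in> polyfun n \<Longrightarrow> L (\<lambda>x. inner h x * p x) = (\<Sum>b\<in>B. inner h b * L (dirD b p))"
begin

text \<open>
  The Hermite polynomial in the linear form given by \<open>h\<close>, normalized by the variance of this form
  under \<open>L\<close>: the \<open>k\<close>-th Wick power of the form.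
\<close>

definition wick :: "'a \<Rightarrow> nat \<Rightarrow> 'a \<Rightarrow> real" where
  "wick h k x = hermite_var (\<Sum>b\<in>B. (inner h b)\<^sup>2) k (inner h x)"

lemma wick_0: "wick h 0 = (\<lambda>x. 1)"
  by (auto simp: wick_def)

lemma wick_polyfun: "wick h k \<in> polyfun k"
  using hermite_var_polyfun by (simp add: wick_def[abs_def])

lemma dirD_wick: "dirD b (wick h k) = (\<lambda>x. (real k * inner h b) * wick h (k - 1) x)"
  unfolding wick_def[abs_def] dirD_hermite_var ..

lemma L_diff: "p \<in> polyfun n \<Longrightarrow> q \<in> polyfun n \<Longrightarrow> L (\<lambda>x. p x - q x) = L p - L q"
  using L_add[of p n "\<lambda>x. (-1) * q x"] L_scale[of q n "-1"] polyfun.scale[of q n "-1"] by simp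

text \<open>Multiplication by Hermite polynomials is adjoint to iterated differentiation.\<close>

lemma L_wick_Suc:
  assumes q: "q \<in> polyfun n"
  shows "L (\<lambda>x. wick h (Suc k) x * q x) = (\<Sum>b\<in>B. inner h b * L (\<lambda>x. wick h k x * dirD b q x))"
proof -
  define s where "s = (\<Sum>b\<in>B. (inner h b)\<^sup>2)"
  note w = polyfun_mult[OF wick_polyfun q]
  have 1: "(\<lambda>x. inner h x * (wick h k x * q x)) \<in> polyfun (Suc (k + n))"
    by (intro polyfun_linear_mult w)
  have 2: "(\<lambda>x. wick h (k - 1) x * q x) \<in> polyfun (Suc (k + n))"
    by (rule polyfun_mono[OF w]) auto
  have "(\<lambda>x. wick h (Suc k) x * q x) =
      (\<lambda>x. inner h x * (wick h k x * q x) - (real k * s) * (wick h (k - 1) x * q x))"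
    by (auto simp: wick_def s_def algebra_simps fun_eq_iff)
  then have "L (\<lambda>x. wick h (Suc k) x * q x) =
      L (\<lambda>x. inner h x * (wick h k x * q x)) - real k * s * L (\<lambda>x. wick h (k - 1) x * q x)"
    using L_diff[OF 1 polyfun.scale[OF 2, of "real k * s"]] L_scale[OF 2, of "real k * s"] by simp
  also have "L (\<lambda>x. inner h x * (wick h k x * q x)) =
      (\<Sum>b\<in>B. inner h b * L (dirD b (\<lambda>x. wick h k x * q x)))"
    by (rule integration_by_parts[OF w])
  also have "\<dots> = (\<Sum>b\<in>B. inner h b * (real k * inner h b * L (\<lambda>x. wick h (k - 1) x * q x)
      + L (\<lambda>x. wick h k x * dirD b q x)))"
  proof (intro sum.cong refl)
    fix b
    have "dirD b (\<lambda>x. wick h k x * q x) =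
        (\<lambda>x. (real k * inner h b) * (wick h (k - 1) x * q x) + wick h k x * dirD b q x)"
      unfolding dirD_mult[OF wick_polyfun q] dirD_wick by (simp add: mult_ac)
    moreover have "(\<lambda>x. wick h k x * dirD b q x) \<in> polyfun (Suc (k + n))"
      by (rule polyfun_mono[OF polyfun_mult[OF wick_polyfun dirD_polyfun'[OF q]]]) auto
    ultimately have "L (dirD b (\<lambda>x. wick h k x * q x)) = real k * inner h b * L (\<lambda>x. wick h (k - 1) x * q x)
        + L (\<lambda>x. wick h k x * dirD b q x)"
      using L_add[OF polyfun.scale[OF 2]] L_scale[OF 2] by simp
    then show "inner h b * L (dirD b (\<lambda>x. wick h k x * q x)) =
        inner h b * (real k * inner h b * L (\<lambda>x. wick h (k - 1) x * q x) + L (\<lambda>x. wick h k x * dirD b q x))"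
      by simp
  qed
  also have "\<dots> = real k * s * L (\<lambda>x. wick h (k - 1) x * q x) +
      (\<Sum>b\<in>B. inner h b * L (\<lambda>x. wick h k x * dirD b q x))"
    by (simp add: s_def sum_distrib_left sum_distrib_right power2_eq_square sum.distrib[symmetric] algebra_simps)
  finally show ?thesis by simp
qed

lemma L_wick: "L (wick h k) = (if k = 0 then 1 else 0)"
proof (cases k)
  case 0
  then show ?thesis by (simp add: wick_0)
next
  case (Suc j)
  then show ?thesis using L_wick_Suc[of "\<lambda>x. 1" 0 h j] by auto
qed

lemma pairing_wick:
  assumes "q \<in> polyfun n"
  shows "deriv_pairing B L m (wick h k) q = (if m = k then L (\<lambda>x. wick h k x * q x) else 0)"
  using assms
proof (induction m arbitrary: k q)
  case 0
  then show ?case by (auto simp: L_wick wick_0)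
next
  case (Suc m)
  have *: "deriv_pairing B L m (dirD b (wick h k)) (dirD b q) =
      (real k * inner h b) * (if m = k - 1 then L (\<lambda>x. wick h (k - 1) x * dirD b q x) else 0)" for b
    unfolding dirD_wick
    using pairing_scale_left[OF wick_polyfun, of m "real k * inner h b" h "k - 1" "dirD b q"]
      Suc.IH[OF dirD_polyfun'[OF Suc.prems], of "k - 1" b] by simp
  show ?case
  proof (cases k)
    case 0
    then show ?thesis by (simp add: *[unfolded 0])
  next
    case (Suc j)
    show ?thesis
    proof (cases "m = j")
      case True
      have "(\<Sum>b\<in>B. deriv_pairing B L m (dirD b (wick h k)) (dirD b q)) =
          real (Suc j) * (\<Sum>b\<in>B. inner h b * L (\<lambda>x. wick h j x * dirD b q x))"
        by (simp add: Suc True *[unfolded Suc True] sum_distrib_left mult_ac)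
      then show ?thesis using True Suc L_wick_Suc[OF Suc.prems, of h j] by simp
    next
      case False
      then show ?thesis using Suc by (simp add: *[unfolded Suc])
    qed
  qed
qed

text \<open>
  The chaos decomposition: the pairings are the inner products of the components in the different
  chaoses. Both sides are linear in \<open>p\<close>, and powers of a linear form are linear combinations of
  Hermite polynomials, for which the formula is the preceding lemma.
\<close>

theorem chaos_decomposition:
  assumes "p \<in> polyfun n" "q \<in> polyfun l" "n \<le> N"
  shows "L (\<lambda>x. p x * q x) = (\<Sum>m\<le>N. deriv_pairing B L m p q)"
  using assms(1)
proof (induction rule: polyfun.induct)
  case (power a h)
  define s where "s = (\<Sum>b\<in>B. (inner h b)\<^sup>2)"
  \<comment> \<open>The three-term recursion trades a factor \<open>inner h x\<close> for a shift of the order of the Hermite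
    polynomial, so the claim is proved for all mixed products by induction on the power.\<close>
  have "L (\<lambda>x. (inner h x ^ a * wick h k x) * q x) =
      (\<Sum>m\<le>N. deriv_pairing B L m (\<lambda>x. inner h x ^ a * wick h k x) q)" if "a + k \<le> N" for k
    using that
  proof (induction a arbitrary: k)
    case 0
    then show ?case by (simp add: pairing_wick[OF assms(2)] sum.delta)
  next
    case (Suc a)
    have poly: "(\<lambda>x. inner h x ^ a * wick h j x) \<in> polyfun N" if "a + j \<le> N" for j
      by (rule polyfun_mono[OF polyfun_mult[OF polyfun.power[of a a] wick_polyfun]]) (use that in auto)
    note p1 = poly[of "Suc k"] and p2 = poly[of "k - 1"]
    have le: "a + Suc k \<le> N" "a + (k - 1) \<le> N" using Suc.prems by auto
    have q: "(\<lambda>x. u x * q x) \<in> polyfun (N + l)" if "u \<in> polyfun N" for u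
      using that assms(2) by (rule polyfun_mult)
    have eq: "(\<lambda>x. inner h x ^ Suc a * wick h k x) =
      (\<lambda>x. inner h x ^ a * wick h (Suc k) x + (real k * s) * (inner h x ^ a * wick h (k - 1) x))"
      by (auto simp: wick_def s_def[symmetric] algebra_simps)
    have "(\<lambda>x. (inner h x ^ Suc a * wick h k x) * q x) =
        (\<lambda>x. (inner h x ^ a * wick h (Suc k) x) * q x
          + (real k * s) * ((inner h x ^ a * wick h (k - 1) x) * q x))"
      by (auto simp: wick_def s_def[symmetric] algebra_simps)
    then have "L (\<lambda>x. (inner h x ^ Suc a * wick h k x) * q x) =
        L (\<lambda>x. (inner h x ^ a * wick h (Suc k) x) * q x) +
        real k * s * L (\<lambda>x. (inner h x ^ a * wick h (k - 1) x) * q x)"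
      using L_add[OF q[OF p1] polyfun.scale[OF q[OF p2]]] L_scale[OF q[OF p2]] le by simp
    also have "\<dots> = (\<Sum>m\<le>N. deriv_pairing B L m (\<lambda>x. inner h x ^ a * wick h (Suc k) x) q
        + real k * s * deriv_pairing B L m (\<lambda>x. inner h x ^ a * wick h (k - 1) x) q)"
      using Suc.IH[OF le(1)] Suc.IH[OF le(2)] by (simp add: sum.distrib sum_distrib_left)
    also have "\<dots> = (\<Sum>m\<le>N. deriv_pairing B L m (\<lambda>x. inner h x ^ Suc a * wick h k x) q)"
      unfolding eq
      using pairing_add_left[OF p1 polyfun.scale[OF p2]] pairing_scale_left[OF p2] le
      by (intro sum.cong refl) simp
    finally show ?case .
  qed
  from this[of 0] show ?case using power assms(3) by (simp add: wick_0)
next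
  case (add p p')
  have "L (\<lambda>x. (p x + p' x) * q x) = L (\<lambda>x. p x * q x) + L (\<lambda>x. p' x * q x)"
    using L_add[OF polyfun_mult[OF add.hyps(1) assms(2)] polyfun_mult[OF add.hyps(2) assms(2)]]
    by (simp add: algebra_simps)
  then show ?case by (simp add: add.IH pairing_add_left[OF add.hyps] sum.distrib)
next
  case (scale p c)
  have "L (\<lambda>x. (c * p x) * q x) = c * L (\<lambda>x. p x * q x)"
    using L_scale[OF polyfun_mult[OF scale.hyps assms(2)], of c] by (simp add: algebra_simps)
  then show ?case by (simp add: scale.IH pairing_scale_left[OF scale.hyps] sum_distrib_left)
qed

text \<open>
  All components contribute nonnegatively to the second moment, and the one of top order does not
  depend on the functional because derivatives of top order are constant.
\<close>

corollary fischer_le_second_moment: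
  assumes "p \<in> polyfun n"
  shows "deriv_pairing B (\<lambda>p. p 0) n p p \<le> L (\<lambda>x. p x * p x)"
proof -
  have "deriv_pairing B L n p p \<le> (\<Sum>m\<le>n. deriv_pairing B L m p p)"
    by (rule member_le_sum) (auto simp: deriv_pairing_nonneg)
  then show ?thesis
    using chaos_decomposition[OF assms assms order_refl] pairing_top_degree[OF assms assms] by simp
qed

lemma L_cauchy_schwarz:
  assumes "p \<in> polyfun n" "q \<in> polyfun n"
  shows "(L (\<lambda>x. p x * q x))\<^sup>2 \<le> L (\<lambda>x. p x * p x) * L (\<lambda>x. q x * q x)"
proof -
  define a b c where "a = L (\<lambda>x. p x * p x)" and "b = L (\<lambda>x. p x * q x)" and "c = L (\<lambda>x. q x * q x)"
  have quad: "0 \<le> a + 2 * t * b + t\<^sup>2 * c" for t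
  proof -
    note m = polyfun_mult[OF assms(1,1)] polyfun_mult[OF assms(1,2)] polyfun_mult[OF assms(2,2)]
    have "(\<lambda>x. (p x + t * q x) * (p x + t * q x)) =
        (\<lambda>x. (p x * p x + (2 * t) * (p x * q x)) + t\<^sup>2 * (q x * q x))"
      by (auto simp: algebra_simps power2_eq_square)
    then have "L (\<lambda>x. (p x + t * q x) * (p x + t * q x)) = a + 2 * t * b + t\<^sup>2 * c"
      using L_add[OF polyfun.add[OF m(1) polyfun.scale[OF m(2), of "2 * t"]] polyfun.scale[OF m(3), of "t\<^sup>2"]]
        L_add[OF m(1) polyfun.scale[OF m(2), of "2 * t"]] L_scale[OF m(2), of "2 * t"] L_scale[OF m(3), of "t\<^sup>2"]
      by (simp add: a_def b_def c_def)
    then show ?thesis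
      using L_square_nonneg[OF polyfun.add[OF assms(1) polyfun.scale[OF assms(2)]], of t] by simp
  qed
  have "b\<^sup>2 \<le> a * c"
  proof (cases "c = 0")
    case True
    have "b = 0"
    proof (rule ccontr)
      assume "b \<noteq> 0"
      then have "2 * (- (a + 1) / (2 * b)) * b = - (a + 1)" by simp
      \<comment> \<open>the value of \<open>t\<close> at which the affine function \<open>a + 2 t b\<close> is \<open>-1\<close>\<close>
      then show False using quad[of "- (a + 1) / (2 * b)"] True by simp
    qed
    then show ?thesis using True by simp
  next
    case False
    then have "c > 0" using L_square_nonneg[OF assms(2)] by (simp add: c_def)
    then show ?thesis using quad[of "- b / c"] by (simp add: field_simps power2_eq_square)
  qed
  then show ?thesis by (simp add: a_def b_def c_def)
qed

section \<open>Dimension-free moment bounds\<close>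

text \<open>
  In the sum of the second moments of the derivatives along \<open>B\<close>, the chaos component of order \<open>m\<close>
  is weighted by the factor \<open>m\<close>, and only orders up to \<open>n\<close> occur.
\<close>

lemma second_moment_derivative:
  assumes p: "p \<in> polyfun n"
  shows "(\<Sum>b\<in>B. L (\<lambda>x. dirD b p x * dirD b p x)) \<le> real n * L (\<lambda>x. p x * p x)"
proof -
  have "(\<Sum>b\<in>B. L (\<lambda>x. dirD b p x * dirD b p x)) =
      (\<Sum>b\<in>B. \<Sum>m\<le>n. deriv_pairing B L m (dirD b p) (dirD b p))"
    using chaos_decomposition[OF dirD_polyfun'[OF p] dirD_polyfun'[OF p] order_refl] by simp
  also have "\<dots> = (\<Sum>m\<le>n. \<Sum>b\<in>B. deriv_pairing B L m (dirD b p) (dirD b p))"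
    by (rule sum.swap)
  also have "\<dots> = (\<Sum>m\<le>n. real (Suc m) * deriv_pairing B L (Suc m) p p)"
    by (simp del: of_nat_Suc)
  also have "\<dots> \<le> (\<Sum>m\<le>n. real n * deriv_pairing B L (Suc m) p p)"
  proof (rule sum_mono)
    fix m assume "m \<in> {..n}"
    then show "real (Suc m) * deriv_pairing B L (Suc m) p p \<le> real n * deriv_pairing B L (Suc m) p p"
      using pairing_degree[OF p, of "Suc m" p]
      by (cases "m = n") (auto intro!: mult_right_mono deriv_pairing_nonneg simp del: deriv_pairing.simps)
  qed
  also have "\<dots> = real n * (\<Sum>m\<le>n. deriv_pairing B L (Suc m) p p)"
    by (simp add: sum_distrib_left del: deriv_pairing.simps)
  also have "\<dots> \<le> real n * (\<Sum>m\<le>Suc n. deriv_pairing B L m p p)"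
    by (intro mult_left_mono) (simp_all only: sum.atMost_Suc_shift of_nat_0_le_iff, simp add: deriv_pairing_nonneg)
  also have "\<dots> = real n * L (\<lambda>x. p x * p x)"
    using chaos_decomposition[OF p p, of "Suc n"] by simp
  finally show ?thesis .
qed

text \<open>
  Every derivative of \<open>p q\<close> is a sum of two products by the Leibniz rule. Splitting the square costs
  a factor \<open>2\<close>, and each of the two summands contributes a factor \<open>n\<close> by the bound on derivatives;
  \<open>4 n\<close> is the product of \<open>2\<close> and the total \<open>2 n\<close>.
\<close>

lemma pairing_product_bound:
  assumes "p \<in> polyfun n" "q \<in> polyfun n"
  shows "deriv_pairing B L m (\<lambda>x. p x * q x) (\<lambda>x. p x * q x) \<le>
    (4 * real n) ^ m * (L (\<lambda>x. p x * p x) * L (\<lambda>x. q x * q x))"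
  using assms
proof (induction m arbitrary: p q)
  case 0
  then show ?case using L_cauchy_schwarz[of p n q] by (simp add: power2_eq_square)
next
  case (Suc m)
  note p = Suc.prems(1) and q = Suc.prems(2)
  let ?E = "\<lambda>p. L (\<lambda>x. p x * p x)" and ?P = "\<lambda>p. deriv_pairing B L m p p"
  let ?K = "(4 * real n) ^ m"
  have "deriv_pairing B L (Suc m) (\<lambda>x. p x * q x) (\<lambda>x. p x * q x) \<le>
      (\<Sum>b\<in>B. ?P (dirD b (\<lambda>x. p x * q x)))"
  proof -
    have "0 \<le> (\<Sum>b\<in>B. ?P (dirD b (\<lambda>x. p x * q x)))" (is "0 \<le> ?S")
      by (intro sum_nonneg deriv_pairing_nonneg)
    then have "?S / real (Suc m) \<le> ?S / 1" by (intro divide_left_mono) auto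
    then show ?thesis by simp
  qed
  also have "\<dots> \<le> (\<Sum>b\<in>B. 2 * (?K * (?E (dirD b p) * ?E q) + ?K * (?E p * ?E (dirD b q))))"
  proof (rule sum_mono)
    fix b
    have "?P (dirD b (\<lambda>x. p x * q x)) \<le>
        2 * (?P (\<lambda>x. dirD b p x * q x) + ?P (\<lambda>x. p x * dirD b q x))"
      unfolding dirD_mult[OF p q]
      by (rule pairing_square_add_le[where n = "n + n"]) (auto intro!: polyfun_mult dirD_polyfun' p q)
    also have "\<dots> \<le> 2 * (?K * (?E (dirD b p) * ?E q) + ?K * (?E p * ?E (dirD b q)))"
      using Suc.IH[OF dirD_polyfun'[OF p] q, of b] Suc.IH[OF p dirD_polyfun'[OF q], of b] by simp
    finally show "?P (dirD b (\<lambda>x. p x * q x)) \<le>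
        2 * (?K * (?E (dirD b p) * ?E q) + ?K * (?E p * ?E (dirD b q)))" .
  qed
  also have "\<dots> = 2 * ?K * ((\<Sum>b\<in>B. ?E (dirD b p)) * ?E q + ?E p * (\<Sum>b\<in>B. ?E (dirD b q)))"
    by (simp add: sum_distrib_left sum_distrib_right sum.distrib algebra_simps)
  also have "\<dots> \<le> 2 * ?K * ((real n * ?E p) * ?E q + ?E p * (real n * ?E q))"
    by (intro mult_left_mono add_mono mult_right_mono second_moment_derivative p q L_square_nonneg[of _ n]) auto
  also have "\<dots> = (4 * real n) ^ Suc m * (?E p * ?E q)"
    by (simp add: algebra_simps)
  finally show ?case .
qed

end

definition product_const :: "nat \<Rightarrow> real" where
  "product_const n = (\<Sum>m\<le>2 * n. (4 * real n) ^ m)"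

lemma product_const_nonneg: "0 \<le> product_const n"
  by (auto simp: product_const_def intro!: sum_nonneg)

context gaussian_functional
begin

text \<open>
  A weak form of hypercontractivity, obtained by summing the bounds over the chaoses. The constant
  depends on the degree but not on \<open>B\<close>, so the bound survives the passage to infinite dimension.
\<close>

theorem second_moment_product:
  assumes "p \<in> polyfun n" "q \<in> polyfun n"
  shows "L (\<lambda>x. (p x * q x) * (p x * q x)) \<le>
    product_const n * (L (\<lambda>x. p x * p x) * L (\<lambda>x. q x * q x))"
proof -
  have pq: "(\<lambda>x. p x * q x) \<in> polyfun (2 * n)"
    using polyfun_mult[OF assms] unfolding mult_2 .
  have "L (\<lambda>x. (p x * q x) * (p x * q x)) =
      (\<Sum>m\<le>2 * n. deriv_pairing B L m (\<lambda>x. p x * q x) (\<lambda>x. p x * q x))"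
    using chaos_decomposition[OF pq pq order_refl] .
  also have "\<dots> \<le> (\<Sum>m\<le>2 * n. (4 * real n) ^ m * (L (\<lambda>x. p x * p x) * L (\<lambda>x. q x * q x)))"
    by (intro sum_mono pairing_product_bound assms)
  finally show ?thesis by (simp add: product_const_def sum_distrib_right)
qed

lemma second_moment_prod:
  assumes "finite A" "\<And>i. i \<in> A \<Longrightarrow> p i \<in> polyfun (k i)" "(\<Sum>i\<in>A. k i) \<le> n"
  shows "L (\<lambda>x. (\<Prod>i\<in>A. p i x) * (\<Prod>i\<in>A. p i x)) \<le>
    product_const n ^ card A * (\<Prod>i\<in>A. L (\<lambda>x. p i x * p i x))"
  using assms
proof (induction A rule: finite_induct)
  case (insert i A)
  have i: "p i \<in> polyfun n" 
    by (rule polyfun_mono[of "p i" "k i"]) (use insert.prems insert.hyps in auto)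
  have A: "(\<lambda>x. \<Prod>i\<in>A. p i x) \<in> polyfun n"
    by (rule polyfun_mono[OF polyfun_prod[of A p k]]) (use insert.prems insert.hyps in auto)
  have IH: "L (\<lambda>x. (\<Prod>i\<in>A. p i x) * (\<Prod>i\<in>A. p i x)) \<le>
      product_const n ^ card A * (\<Prod>i\<in>A. L (\<lambda>x. p i x * p i x))"
    using insert.prems insert.hyps by (intro insert.IH) auto
  have "L (\<lambda>x. (p i x * (\<Prod>i\<in>A. p i x)) * (p i x * (\<Prod>i\<in>A. p i x))) \<le>
      product_const n * (L (\<lambda>x. p i x * p i x) * L (\<lambda>x. (\<Prod>i\<in>A. p i x) * (\<Prod>i\<in>A. p i x)))"
    by (rule second_moment_product[OF i A])
  also have "\<dots> \<le> product_const n * (L (\<lambda>x. p i x * p i x) *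
      (product_const n ^ card A * (\<Prod>i\<in>A. L (\<lambda>x. p i x * p i x))))"
    by (intro mult_left_mono product_const_nonneg L_square_nonneg[OF i] IH)
  finally show ?case using insert.hyps by (simp add: mult_ac)
qed simp

end

section \<open>Polynomials in an isonormal Gaussian process\<close>

text \<open>The moments of the centered normal law of variance \<open>s\<close>.\<close>

definition normal_moment :: "real \<Rightarrow> nat \<Rightarrow> real" where
  "normal_moment s m = (if even m then fact m / (2 ^ (m div 2) * fact (m div 2)) * s ^ (m div 2) else 0)"

lemma polynomial_deriv_at_0:
  fixes a :: "nat \<Rightarrow> real"
  assumes "1 \<le> n"
  shows "((\<lambda>t. \<Sum>j\<le>n. a j * t ^ j) has_real_derivative a 1) (at 0)"
proof -
  have "((\<lambda>t. \<Sum>j\<le>n. a j * t ^ j) has_real_derivative (\<Sum>j\<le>n. a j * (real j * 0 ^ (j - 1)))) (at 0)"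
    by (intro DERIV_sum DERIV_cmult) (auto intro!: derivative_eq_intros)
  also have "(\<Sum>j\<le>n. a j * (real j * 0 ^ (j - 1))) = (\<Sum>j\<le>n. if j = 1 then a 1 else 0)"
    by (intro sum.cong) (auto simp: power_0_left)
  finally show ?thesis using assms by simp
qed

text \<open>The orthogonal projection to the span of \<open>B\<close>, if \<open>B\<close> is a finite orthonormal set.\<close>

definition onb_proj :: "'h::real_inner set \<Rightarrow> 'h \<Rightarrow> 'h" where
  "onb_proj B h = (\<Sum>b\<in>B. inner h b *\<^sub>R b)"

context isonormal_gaussian_process
begin

lemma gaussian_rv_X: "gaussian_rv M (X h)"
  using gaussian[of "{h}" "\<lambda>_. 1"] by simp

lemma X_measurable [measurable]: "X h \<in> borel_measurable M"
  using gaussian_rv_X[of h] by (auto simp: gaussian_rv_def distributed_def)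

lemma X_moment:
  "integrable M (\<lambda>\<omega>. X h \<omega> ^ m)" "expectation (\<lambda>\<omega>. X h \<omega> ^ m) = normal_moment ((norm h)\<^sup>2) m"
proof -
  have cov: "expectation (\<lambda>\<omega>. X h \<omega> * X h \<omega>) = (norm h)\<^sup>2"
    using covariance[of h h] by (simp add: power2_norm_eq_inner)
  have "integrable M (\<lambda>\<omega>. X h \<omega> ^ m) \<and> expectation (\<lambda>\<omega>. X h \<omega> ^ m) = normal_moment ((norm h)\<^sup>2) m"
    using gaussian_rv_X[of h] unfolding gaussian_rv_def
  proof (elim disjE exE conjE)
    fix \<mu> \<sigma> :: real
    assume \<sigma>: "\<sigma> > 0" and D: "distributed M lborel (X h) (normal_density \<mu> \<sigma>)"
    have "\<mu> = 0" using normal_distributed_expectation[OF \<sigma> D] centered[of h] by simp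
    note D = D[unfolded this]
    have "variance (X h) = \<sigma>\<^sup>2" by (rule normal_distributed_variance[OF \<sigma> D])
    then have s: "(norm h)\<^sup>2 = \<sigma>\<^sup>2" using centered[of h] cov by (simp add: power2_eq_square)
    have "integrable lborel (\<lambda>x. normal_density 0 \<sigma> x * x ^ m)"
      using integrable_normal_moment[OF \<sigma>, of 0 m] by simp
    then have int: "integrable M (\<lambda>\<omega>. X h \<omega> ^ m)"
      using distributed_integrable[OF D, of "\<lambda>x. x ^ m"] by simp
    have "expectation (\<lambda>\<omega>. X h \<omega> ^ m) = (\<integral>x. normal_density 0 \<sigma> x * x ^ m \<partial>lborel)"
      using distributed_integral[OF D, of "\<lambda>x. x ^ m"] by simp
    also have "\<dots> = normal_moment ((norm h)\<^sup>2) m"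
    proof (cases "even m")
      case True
      then obtain q where "m = 2 * q" by (elim evenE)
      then show ?thesis using integral_normal_moment_even[OF \<sigma>, of 0 q] \<sigma>
        by (simp add: normal_moment_def s power_divide)
    next
      case False
      then obtain q where "m = 2 * q + 1" by (elim oddE)
      then show ?thesis using integral_normal_moment_odd[OF \<sigma>, of 0 q]
        by (simp add: normal_moment_def)
    qed
    finally show ?thesis using int by simp
  next
    fix \<mu> assume \<mu>: "AE \<omega> in M. X h \<omega> = \<mu>"
    have "expectation (X h) = expectation (\<lambda>_. \<mu>)" using \<mu> by (intro integral_cong_AE) auto
    then have "\<mu> = 0" using centered[of h] by (simp add: prob_space)
    then have X0: "AE \<omega> in M. X h \<omega> = 0" using \<mu> by simp
    have "expectation (\<lambda>\<omega>. X h \<omega> * X h \<omega>) = expectation (\<lambda>_. 0)"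
      using X0 by (intro integral_cong_AE) auto
    then have s: "(norm h)\<^sup>2 = 0" using cov by simp
    have ae: "AE \<omega> in M. X h \<omega> ^ m = 0 ^ m" using X0 by auto
    have "integrable M (\<lambda>\<omega>. X h \<omega> ^ m) \<longleftrightarrow> integrable M (\<lambda>\<omega>. 0 ^ m :: real)"
      by (rule integrable_cong_AE) (use ae in auto)
    moreover have "expectation (\<lambda>\<omega>. X h \<omega> ^ m) = expectation (\<lambda>\<omega>. 0 ^ m)"
      by (rule integral_cong_AE) (use ae in auto)
    moreover have "normal_moment 0 m = 0 ^ m"
      by (cases m) (auto simp: normal_moment_def elim!: evenE)
    ultimately show ?thesis unfolding s by (simp add: prob_space)
  qed
  then show "integrable M (\<lambda>\<omega>. X h \<omega> ^ m)" "expectation (\<lambda>\<omega>. X h \<omega> ^ m) = normal_moment ((norm h)\<^sup>2) m"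
    by auto
qed

lemma X_product_integrable: "integrable M (\<lambda>\<omega>. X g \<omega> ^ a * X h \<omega> ^ b)"
proof (rule Bochner_Integration.integrable_bound)
  show "integrable M (\<lambda>\<omega>. X g \<omega> ^ (2 * a) + X h \<omega> ^ (2 * b))"
    by (intro Bochner_Integration.integrable_add X_moment)
  have "\<bar>x * y\<bar> \<le> \<bar>x\<^sup>2 + y\<^sup>2\<bar>" for x y :: real
  proof -
    have "0 \<le> (\<bar>x\<bar> - \<bar>y\<bar>)\<^sup>2" by simp
    then have "2 * (\<bar>x\<bar> * \<bar>y\<bar>) \<le> x\<^sup>2 + y\<^sup>2" by (simp add: power2_diff)
    moreover have "0 \<le> \<bar>x\<bar> * \<bar>y\<bar>" by simp
    ultimately have "\<bar>x\<bar> * \<bar>y\<bar> \<le> x\<^sup>2 + y\<^sup>2" by linarith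
    then show ?thesis by (simp add: abs_mult)
  qed
  then show "AE \<omega> in M. norm (X g \<omega> ^ a * X h \<omega> ^ b) \<le> norm (X g \<omega> ^ (2 * a) + X h \<omega> ^ (2 * b))"
    by (intro AE_I2) (simp add: power_even_eq)
qed simp

text \<open>
  The process is almost surely linear in its index, because the covariance makes the second moment
  of the defect vanish.
\<close>

lemma X_linear:
  "AE \<omega> in M. X (g + c *\<^sub>R h) \<omega> = X g \<omega> + c * X h \<omega>"
proof -
  let ?Y = "\<lambda>\<omega>. X (g + c *\<^sub>R h) \<omega> - X g \<omega> - c * X h \<omega>" and ?k = "g + c *\<^sub>R h"
  have int: "integrable M (\<lambda>\<omega>. X u \<omega> * X v \<omega>)" for u v
    using X_product_integrable[of u 1 v 1] by simp
  have sq: "(?Y \<omega>)\<^sup>2 = X ?k \<omega> * X ?k \<omega> + X g \<omega> * X g \<omega> + c\<^sup>2 * (X h \<omega> * X h \<omega>)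
      - 2 * (X ?k \<omega> * X g \<omega>) - 2 * c * (X ?k \<omega> * X h \<omega>) + 2 * c * (X g \<omega> * X h \<omega>)" for \<omega>
    by (simp add: power2_eq_square algebra_simps)
  have "expectation (\<lambda>\<omega>. (?Y \<omega>)\<^sup>2) = inner ?k ?k + inner g g + c\<^sup>2 * inner h h
      - 2 * inner ?k g - 2 * c * inner ?k h + 2 * c * inner g h"
    unfolding sq by (simp add: int covariance)
  also have "\<dots> = 0"
    by (simp add: inner_add_left inner_add_right inner_commute[of h g] power2_eq_square algebra_simps)
  finally have "expectation (\<lambda>\<omega>. (?Y \<omega>)\<^sup>2) = 0" .
  moreover have "integrable M (\<lambda>\<omega>. (?Y \<omega>)\<^sup>2)" unfolding sq by (simp add: int)
  ultimately have "AE \<omega> in M. (?Y \<omega>)\<^sup>2 = 0"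
    using integral_nonneg_eq_0_iff_AE[of M "\<lambda>\<omega>. (?Y \<omega>)\<^sup>2"] by simp
  then show ?thesis by auto
qed

lemma X_zero: "AE \<omega> in M. X 0 \<omega> = 0"
  using X_linear[of 0 1 0] by auto

lemma X_scale: "AE \<omega> in M. X (c *\<^sub>R h) \<omega> = c * X h \<omega>"
  using X_linear[of 0 c h] X_zero by auto

lemma X_sum:
  assumes "finite A"
  shows "AE \<omega> in M. X (\<Sum>a\<in>A. c a *\<^sub>R v a) \<omega> = (\<Sum>a\<in>A. c a * X (v a) \<omega>)"
  using assms
proof (induction A rule: finite_induct)
  case empty
  then show ?case using X_zero by simp
next
  case (insert a A)
  have "AE \<omega> in M. X ((\<Sum>a\<in>A. c a *\<^sub>R v a) + c a *\<^sub>R v a) \<omega> = X (\<Sum>a\<in>A. c a *\<^sub>R v a) \<omega> + c a * X (v a) \<omega>"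
    by (rule X_linear)
  then show ?case using insert by (auto simp: add.commute)
qed

text \<open>
  Integration by parts for powers, from the moments of a single normal variable: both sides of
  the formula for the moment of order \<open>m + 1\<close> of \<open>X (h + t g)\<close> are polynomials in \<open>t\<close>, and the
  claim compares their derivatives at \<open>0\<close>.
\<close>

lemma expectation_X_times_power:
  "expectation (\<lambda>\<omega>. X g \<omega> * X h \<omega> ^ m) = real m * inner g h * expectation (\<lambda>\<omega>. X h \<omega> ^ (m - 1))"
proof -
  define a where "a j = real (Suc m choose j) * expectation (\<lambda>\<omega>. X g \<omega> ^ j * X h \<omega> ^ (Suc m - j))" for j
  have lhs: "normal_moment ((norm (h + t *\<^sub>R g))\<^sup>2) (Suc m) = (\<Sum>j\<le>Suc m. a j * t ^ j)" for t
  proof -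
    have "normal_moment ((norm (h + t *\<^sub>R g))\<^sup>2) (Suc m) = expectation (\<lambda>\<omega>. X (h + t *\<^sub>R g) \<omega> ^ Suc m)"
      by (rule X_moment(2)[symmetric])
    also have "\<dots> = expectation (\<lambda>\<omega>. (t * X g \<omega> + X h \<omega>) ^ Suc m)"
      by (intro integral_cong_AE) (use X_linear[of h t g] in \<open>auto simp: add.commute\<close>)
    also have "\<dots> = expectation (\<lambda>\<omega>. \<Sum>j\<le>Suc m. (real (Suc m choose j) * t ^ j) * (X g \<omega> ^ j * X h \<omega> ^ (Suc m - j)))"
      by (subst binomial_ring) (simp add: power_mult_distrib mult_ac)
    also have "\<dots> = (\<Sum>j\<le>Suc m. a j * t ^ j)"
      by (subst Bochner_Integration.integral_sum) (auto simp: X_product_integrable a_def mult_ac)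
    finally show ?thesis .
  qed
  have d1: "((\<lambda>t. normal_moment ((norm (h + t *\<^sub>R g))\<^sup>2) (Suc m)) has_real_derivative a 1) (at 0)"
    unfolding lhs by (rule polynomial_deriv_at_0) simp
  have d2: "((\<lambda>t. normal_moment ((norm (h + t *\<^sub>R g))\<^sup>2) (Suc m)) has_real_derivative
      real (Suc m) * (real m * inner g h * normal_moment ((norm h)\<^sup>2) (m - 1))) (at 0)"
  proof (cases "even m")
    case True
    then have "normal_moment s (Suc m) = 0" for s by (simp add: normal_moment_def)
    moreover have "real m * c * normal_moment s (m - 1) = 0" for c s
      using True by (cases m) (auto simp: normal_moment_def)
    ultimately show ?thesis by (simp only: mult_zero_right DERIV_const)
  next
    case False
    then obtain q where m: "m = 2 * q + 1" by (elim oddE)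
    define C :: real where "C = fact (Suc m) / (2 ^ Suc q * fact (Suc q))"
    have nm: "normal_moment s (Suc m) = C * s ^ Suc q" for s
      by (simp add: normal_moment_def m C_def)
    have sq: "(norm (h + t *\<^sub>R g))\<^sup>2 = (norm h)\<^sup>2 + t * (2 * inner g h) + t\<^sup>2 * (norm g)\<^sup>2" for t
      unfolding power2_norm_eq_inner
      by (simp add: inner_add_left inner_add_right inner_commute[of h g] power2_eq_square algebra_simps)
    have "((\<lambda>t. C * ((norm h)\<^sup>2 + t * (2 * inner g h) + t\<^sup>2 * (norm g)\<^sup>2) ^ Suc q) has_real_derivative
      C * (real (Suc q) * (2 * inner g h) * ((norm h)\<^sup>2) ^ q)) (at 0)"
    proof -
      have "((\<lambda>t. (norm h)\<^sup>2 + t * (2 * inner g h) + t\<^sup>2 * (norm g)\<^sup>2) has_real_derivative 2 * inner g h) (at 0)"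
        by (auto intro!: derivative_eq_intros)
      from DERIV_cmult[OF DERIV_power[OF this, of "Suc q"], of C] show ?thesis
        by (simp add: algebra_simps)
    qed
    also have "C * (real (Suc q) * (2 * inner g h) * ((norm h)\<^sup>2) ^ q) =
        real (Suc m) * (real m * inner g h * normal_moment ((norm h)\<^sup>2) (m - 1))"
    proof -
      have "C * (real (Suc q) * 2) = real (Suc m) * (real m * (fact (2 * q) / (2 ^ q * fact q)))"
        by (simp add: C_def m divide_simps)
      then have "(C * (real (Suc q) * 2)) * (inner g h * ((norm h)\<^sup>2) ^ q) =
          (real (Suc m) * (real m * (fact (2 * q) / (2 ^ q * fact q)))) * (inner g h * ((norm h)\<^sup>2) ^ q)"
        by simp
      moreover have "normal_moment ((norm h)\<^sup>2) (m - 1) = fact (2 * q) / (2 ^ q * fact q) * ((norm h)\<^sup>2) ^ q"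
        by (simp add: normal_moment_def m)
      ultimately show ?thesis by (simp only: mult_ac)
    qed
    finally show ?thesis unfolding nm sq .
  qed
  have "a 1 = real (Suc m) * (real m * inner g h * normal_moment ((norm h)\<^sup>2) (m - 1))"
    by (rule DERIV_unique[OF d1 d2])
  moreover have "a 1 = real (Suc m) * expectation (\<lambda>\<omega>. X g \<omega> * X h \<omega> ^ m)"
    by (simp add: a_def)
  ultimately show ?thesis by (simp add: X_moment(2) del: of_nat_Suc)
qed

text \<open>
  For orthonormal \<open>B\<close>, this is a standard Gaussian vector in the span of \<open>B\<close>. Polynomials in the
  process are obtained by evaluating polynomial functions on the Hilbert space at it.
\<close>

definition gvec :: "'h set \<Rightarrow> 'a \<Rightarrow> 'h" where
  "gvec B \<omega> = (\<Sum>b\<in>B. X b \<omega> *\<^sub>R b)"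

lemma inner_gvec: "inner h (gvec B \<omega>) = (\<Sum>b\<in>B. X b \<omega> * inner h b)"
  by (simp add: gvec_def inner_sum_right)

lemma inner_gvec_AE: "finite B \<Longrightarrow> AE \<omega> in M. inner h (gvec B \<omega>) = X (onb_proj B h) \<omega>"
  using X_sum[of B "inner h" "\<lambda>b. b"] by (auto simp: inner_gvec onb_proj_def mult.commute)

lemma inner_gvec_measurable [measurable]: "(\<lambda>\<omega>. inner h (gvec B \<omega>)) \<in> borel_measurable M"
  unfolding inner_gvec by measurable

lemma polyfun_gvec_measurable: "p \<in> polyfun n \<Longrightarrow> (\<lambda>\<omega>. p (gvec B \<omega>)) \<in> borel_measurable M"
  by (induction rule: polyfun.induct) auto

lemma polyfun_gvec_integrable:
  assumes "finite B" "p \<in> polyfun n"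
  shows "integrable M (\<lambda>\<omega>. p (gvec B \<omega>))"
  using assms(2)
proof (induction rule: polyfun.induct)
  case (power m h)
  have "integrable M (\<lambda>\<omega>. inner h (gvec B \<omega>) ^ m) \<longleftrightarrow> integrable M (\<lambda>\<omega>. X (onb_proj B h) \<omega> ^ m)"
    by (rule integrable_cong_AE) (use inner_gvec_AE[OF assms(1), of h] in auto)
  then show ?case using X_moment(1) by simp
qed auto

abbreviation gexp :: "'h set \<Rightarrow> ('h \<Rightarrow> real) \<Rightarrow> real" where
  "gexp B p \<equiv> expectation (\<lambda>\<omega>. p (gvec B \<omega>))"

lemma gexp_integration_by_parts_basis:
  assumes B: "finite_orthonormal B" and b: "b \<in> B" and "p \<in> polyfun n"
  shows "gexp B (\<lambda>x. inner b x * p x) = gexp B (dirD b p)"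
  using assms(3)
proof (induction rule: polyfun.induct)
  case (power m h)
  have fin: "finite B" using B by (simp add: finite_orthonormal_def)
  have orth: "inner b c = (if c = b then 1 else 0)" if "c \<in> B" for c
    using B b that by (auto simp: finite_orthonormal_def pairwise_def orthogonal_def norm_eq_1)
  have Xb: "inner b (gvec B \<omega>) = X b \<omega>" for \<omega>
    using fin b by (simp add: inner_gvec orth sum.delta if_distrib cong: if_cong sum.cong)
  have ib: "inner b (onb_proj B h) = inner h b"
    using fin b by (simp add: onb_proj_def inner_sum_right orth sum.delta if_distrib cong: if_cong sum.cong)
  note ae = inner_gvec_AE[OF fin, of h]
  have "gexp B (\<lambda>x. inner b x * inner h x ^ m) = expectation (\<lambda>\<omega>. X b \<omega> * X (onb_proj B h) \<omega> ^ m)"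
    unfolding Xb by (rule integral_cong_AE) (use ae in auto)
  also have "\<dots> = real m * inner h b * expectation (\<lambda>\<omega>. X (onb_proj B h) \<omega> ^ (m - 1))"
    by (simp add: expectation_X_times_power ib)
  also have "expectation (\<lambda>\<omega>. X (onb_proj B h) \<omega> ^ (m - 1)) = gexp B (\<lambda>x. inner h x ^ (m - 1))"
    by (rule integral_cong_AE) (use ae in auto)
  finally show ?case by (simp add: dirD_power)
next
  case (add p q)
  have fin: "finite B" using B by (simp add: finite_orthonormal_def)
  note i = polyfun_gvec_integrable[OF fin polyfun_linear_mult[OF add.hyps(1), of b]]
    polyfun_gvec_integrable[OF fin polyfun_linear_mult[OF add.hyps(2), of b]]
    polyfun_gvec_integrable[OF fin dirD_polyfun[OF add.hyps(1), of b]]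
    polyfun_gvec_integrable[OF fin dirD_polyfun[OF add.hyps(2), of b]]
  show ?case using add.IH i by (simp add: dirD_add[OF add.hyps] distrib_left)
next
  case (scale p c)
  then show ?case by (simp add: dirD_scale[OF scale.hyps] mult.left_commute[of _ c])
qed

lemma gaussian_functional_gexp:
  assumes B: "finite_orthonormal B"
  shows "gaussian_functional B (gexp B)"
proof
  have fin: "finite B" using B by (simp add: finite_orthonormal_def)
  note int = polyfun_gvec_integrable[OF fin]
  show "gexp B (\<lambda>x. p x + q x) = gexp B p + gexp B q" if "p \<in> polyfun n" "q \<in> polyfun n" for p q n
    using int[OF that(1)] int[OF that(2)] by simp
  show "gexp B (\<lambda>x. c * p x) = c * gexp B p" if "p \<in> polyfun n" for p n c
    by simp
  show "gexp B (\<lambda>x. 1) = 1" by (simp add: prob_space)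
  show "finite B" by fact
  show "0 \<le> gexp B (\<lambda>x. p x * p x)" for p by simp
  show "gexp B (\<lambda>x. inner h x * p x) = (\<Sum>b\<in>B. inner h b * gexp B (dirD b p))"
    if p: "p \<in> polyfun n" for p h n
  proof -
    have orth: "inner b c = (if c = b then 1 else 0)" if "b \<in> B" "c \<in> B" for b c
      using B that by (auto simp: finite_orthonormal_def pairwise_def orthogonal_def norm_eq_1)
    have Xb: "inner b (gvec B \<omega>) = X b \<omega>" if "b \<in> B" for \<omega> b
      using fin that by (simp add: inner_gvec orth[OF that] sum.delta if_distrib cong: if_cong sum.cong)
    have "inner h (gvec B \<omega>) = (\<Sum>b\<in>B. inner h b * inner b (gvec B \<omega>))" for \<omega>
      unfolding inner_gvec[of h] by (intro sum.cong) (auto simp: Xb)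
    then have "gexp B (\<lambda>x. inner h x * p x) =
        expectation (\<lambda>\<omega>. \<Sum>b\<in>B. inner h b * (inner b (gvec B \<omega>) * p (gvec B \<omega>)))"
      by (simp add: sum_distrib_right mult.assoc)
    also have "\<dots> = (\<Sum>b\<in>B. inner h b * gexp B (\<lambda>x. inner b x * p x))"
      using int[OF polyfun_linear_mult[OF p]] by (subst Bochner_Integration.integral_sum) auto
    also have "\<dots> = (\<Sum>b\<in>B. inner h b * gexp B (dirD b p))"
      using gexp_integration_by_parts_basis[OF B _ p] by (intro sum.cong) auto
    finally show ?thesis .
  qed
qed

end

section \<open>Finite orthonormal sets\<close>

lemma finite_orthonormalD:
  assumes "finite_orthonormal B"
  shows "finite B" and "b \<in> B \<Longrightarrow> c \<in> B \<Longrightarrow> inner b c = (if c = b then 1 else 0)"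
  using assms by (auto simp: finite_orthonormal_def pairwise_def orthogonal_def norm_eq_1)

lemma linear_onb_proj: "linear (onb_proj B)"
  by (intro linearI)
    (auto simp: onb_proj_def inner_add_left scaleR_add_left sum.distrib scaleR_sum_right)

lemma inner_onb_proj_left: "inner (onb_proj B g) h = (\<Sum>b\<in>B. inner g b * inner b h)"
  by (simp add: onb_proj_def inner_sum_left)

lemma inner_onb_proj:
  assumes "finite_orthonormal B" "b \<in> B"
  shows "inner (onb_proj B h) b = inner h b"
proof -
  have "inner (onb_proj B h) b = (\<Sum>c\<in>B. if c = b then inner h b else 0)"
    unfolding inner_onb_proj_left using finite_orthonormalD(2)[OF assms(1)] assms(2)
    by (intro sum.cong) auto
  then show ?thesis using finite_orthonormalD(1)[OF assms(1)] assms(2) by simp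
qed

lemma onb_proj_basis:
  assumes "finite_orthonormal B" "b \<in> B"
  shows "onb_proj B b = b"
proof -
  have "onb_proj B b = (\<Sum>c\<in>B. if c = b then b else 0)"
    unfolding onb_proj_def using finite_orthonormalD(2)[OF assms(1) assms(2)]
    by (intro sum.cong) auto
  then show ?thesis using finite_orthonormalD(1)[OF assms(1)] assms(2) by simp
qed

lemma bessel_inequality:
  assumes "finite_orthonormal B"
  shows "(\<Sum>b\<in>B. (inner h b)\<^sup>2) \<le> (norm h)\<^sup>2"
proof -
  let ?p = "onb_proj B h"
  have hp: "inner ?p h = (\<Sum>b\<in>B. (inner h b)\<^sup>2)"
    unfolding inner_onb_proj_left by (simp add: power2_eq_square inner_commute[of _ h])
  have "inner ?p ?p = (\<Sum>b\<in>B. inner h b * inner b ?p)"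
    by (rule inner_onb_proj_left)
  also have "\<dots> = (\<Sum>b\<in>B. (inner h b)\<^sup>2)"
    using inner_onb_proj[OF assms] by (intro sum.cong) (auto simp: power2_eq_square inner_commute)
  finally have pp: "inner ?p ?p = (\<Sum>b\<in>B. (inner h b)\<^sup>2)" .
  have "0 \<le> inner (h - ?p) (h - ?p)" by simp
  also have "\<dots> = inner h h - (\<Sum>b\<in>B. (inner h b)\<^sup>2)"
    by (simp add: inner_diff_left inner_diff_right hp pp inner_commute[of h ?p])
  finally show ?thesis by (simp add: power2_norm_eq_inner)
qed

lemma gram_schmidt_extension:
  assumes "finite C" "finite_orthonormal B"
  shows "\<exists>B'. B \<subseteq> B' \<and> finite_orthonormal B' \<and> (\<forall>c\<in>C. onb_proj B' c = c)"
  using assms(1)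
proof (induction C rule: finite_induct)
  case empty
  then show ?case using assms(2) by auto
next
  case (insert c C)
  then obtain B' where B': "B \<subseteq> B'" "finite_orthonormal B'" "\<And>c. c \<in> C \<Longrightarrow> onb_proj B' c = c"
    by auto
  define r where "r = c - onb_proj B' c"
  show ?case
  proof (cases "r = 0")
    case True
    then show ?thesis using B' by (intro exI[of _ B']) (auto simp: r_def)
  next
    case False
    define u where "u = r /\<^sub>R norm r"
    have orth: "inner r b = 0" if "b \<in> B'" for b
      using inner_onb_proj[OF B'(2) that, of c] by (simp add: r_def inner_diff_left)
    then have uorth: "inner b u = 0" "inner u b = 0" if "b \<in> B'" for b
      using that by (simp_all add: u_def inner_commute)
    have nu: "norm u = 1" using False by (simp add: u_def)
    have "u \<notin> B'" using uorth(1)[of u] nu by (auto simp: norm_eq_1)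
    have fin: "finite B'" by (rule finite_orthonormalD[OF B'(2)])
    have ext: "onb_proj (insert u B') h = onb_proj B' h + inner h u *\<^sub>R u" for h
      using fin \<open>u \<notin> B'\<close> by (simp add: onb_proj_def add.commute)
    have pu: "inner (onb_proj B' h) u = 0" for h
      using uorth by (simp add: inner_onb_proj_left)
    have "finite_orthonormal (insert u B')"
      using B'(2) nu uorth by (auto simp: finite_orthonormal_def pairwise_insert orthogonal_def)
    moreover have "onb_proj (insert u B') h = h" if "h \<in> C" for h
      using pu[of h] B'(3)[OF that] by (simp add: ext)
    moreover have "onb_proj (insert u B') c = c"
    proof -
      have "inner c u = inner r u" using pu[of c] by (simp add: r_def inner_diff_left)
      also have "\<dots> = norm r" using False by (simp add: u_def power2_norm_eq_inner[symmetric] power2_eq_square)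
      finally have "inner c u *\<^sub>R u = r" using False by (simp add: u_def)
      then show ?thesis by (simp add: ext r_def)
    qed
    ultimately show ?thesis using B'(1) by (intro exI[of _ "insert u B'"]) auto
  qed
qed

section \<open>Finite-rank approximation of tensors\<close>

lemma hs_sum_tuples: "hs_sum k t B = (\<Sum>bs\<in>tuples B k. (t bs)\<^sup>2)"
  by (simp add: hs_sum_def tuples_def)

lemma multilinear_Cons: "multilinear (Suc k) t \<Longrightarrow> multilinear k (\<lambda>xs. t (x # xs))"
  unfolding multilinear_def
proof (intro allI impI)
  fix xs :: "'a list" and i
  assume *: "\<forall>xs i. length xs = Suc k \<and> i < Suc k \<longrightarrow> linear (\<lambda>x. t (xs[i := x]))"
    and "length xs = k \<and> i < k"
  then show "linear (\<lambda>y. t (x # xs[i := y]))"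
    using *[rule_format, of "x # xs" "Suc i"] by simp
qed

lemma multilinear_linear_head:
  assumes "multilinear (Suc k) t" "length xs = k"
  shows "linear (\<lambda>x. t (x # xs))"
  using assms unfolding multilinear_def by (auto dest!: spec[of _ "undefined # xs"] spec[of _ "0::nat"])

lemma linear_onb_expansion:
  fixes \<phi> :: "'h::real_inner \<Rightarrow> real"
  assumes "linear \<phi>"
  shows "\<phi> (onb_proj B x) = (\<Sum>b\<in>B. inner x b * \<phi> b)"
  using assms by (simp add: onb_proj_def linear_sum linear_scale)

text \<open>
  Enlarging the span of the orthonormal set can only increase the Hilbert-Schmidt sum: one argument
  at a time, this is Bessel's inequality. In particular the sum depends only on the span.
\<close>

lemma hs_sum_mono:
  fixes t :: "'h::real_inner tensor"
  assumes "multilinear k t" "finite_orthonormal C" "finite_orthonormal B" "\<And>c. c \<in> C \<Longrightarrow> onb_proj B c = c"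
  shows "hs_sum k t C \<le> hs_sum k t B"
  using assms(1)
proof (induction k arbitrary: t)
  case 0
  then show ?case by (simp add: hs_sum_tuples sum_tuples_0)
next
  case (Suc k)
  note fin = finite_orthonormalD(1)[OF assms(2)] finite_orthonormalD(1)[OF assms(3)]
  have "hs_sum (Suc k) t C = (\<Sum>c\<in>C. hs_sum k (\<lambda>xs. t (c # xs)) C)"
    by (simp add: hs_sum_tuples sum_tuples_Suc fin)
  also have "\<dots> \<le> (\<Sum>c\<in>C. hs_sum k (\<lambda>xs. t (c # xs)) B)"
    by (intro sum_mono Suc.IH multilinear_Cons Suc.prems)
  also have "\<dots> = (\<Sum>bs\<in>tuples B k. \<Sum>c\<in>C. (t (c # bs))\<^sup>2)"
    unfolding hs_sum_tuples by (rule sum.swap)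
  also have "\<dots> \<le> (\<Sum>bs\<in>tuples B k. \<Sum>b\<in>B. (t (b # bs))\<^sup>2)"
  proof (rule sum_mono)
    fix bs assume "bs \<in> tuples B k"
    then have lin: "linear (\<lambda>x. t (x # bs))"
      using multilinear_linear_head[OF Suc.prems] by (simp add: tuples_def)
    \<comment> \<open>the vector that represents the functional \<open>x \<mapsto> t (x # bs)\<close> on the span of \<open>B\<close>\<close>
    define v where "v = (\<Sum>b\<in>B. t (b # bs) *\<^sub>R b)"
    have "t (c # bs) = inner v c" if "c \<in> C" for c
      using linear_onb_expansion[OF lin, of B c] assms(4)[OF that]
      by (simp add: v_def inner_sum_left inner_commute[of c] mult.commute)
    then have "(\<Sum>c\<in>C. (t (c # bs))\<^sup>2) = (\<Sum>c\<in>C. (inner v c)\<^sup>2)" by simp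
    also have "\<dots> \<le> (norm v)\<^sup>2" by (rule bessel_inequality[OF assms(2)])
    also have "\<dots> = (\<Sum>b\<in>B. t (b # bs) * inner b v)"
      unfolding power2_norm_eq_inner by (subst (1) v_def) (simp add: inner_sum_left)
    also have "\<dots> = (\<Sum>b\<in>B. (t (b # bs))\<^sup>2)"
    proof (intro sum.cong refl)
      fix b assume b: "b \<in> B"
      have "inner b v = (\<Sum>c\<in>B. if c = b then t (b # bs) else 0)"
        unfolding v_def inner_sum_right
        using finite_orthonormalD(2)[OF assms(3) b] by (intro sum.cong) auto
      then show "t (b # bs) * inner b v = (t (b # bs))\<^sup>2"
        using fin b by (simp add: power2_eq_square)
    qed
    finally show "(\<Sum>c\<in>C. (t (c # bs))\<^sup>2) \<le> (\<Sum>b\<in>B. (t (b # bs))\<^sup>2)" .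
  qed
  also have "\<dots> = hs_sum (Suc k) t B"
    unfolding hs_sum_tuples sum_tuples_Suc[OF fin(2)] by (rule sum.swap)
  finally show ?case .
qed

text \<open>The compression of a tensor to the span of \<open>B\<close>.\<close>

definition tproj :: "'h::real_inner set \<Rightarrow> 'h tensor \<Rightarrow> 'h tensor" where
  "tproj B t xs = t (map (onb_proj B) xs)"

lemma tproj_tuples:
  assumes "finite_orthonormal B" "bs \<in> tuples B k"
  shows "tproj B t bs = t bs"
proof -
  have "map (onb_proj B) bs = bs"
    using assms by (intro map_idI onb_proj_basis) (auto simp: tuples_def)
  then show ?thesis by (simp add: tproj_def)
qed

lemma tproj_expansion:
  assumes "multilinear k t" "finite B" "length xs = k"
  shows "tproj B t xs = (\<Sum>bs\<in>tuples B k. t bs * (\<Prod>i<k. inner (bs ! i) (xs ! i)))"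
  using assms(1,3)
proof (induction k arbitrary: t xs)
  case 0
  then show ?case by (simp add: tproj_def sum_tuples_0)
next
  case (Suc k)
  then obtain x ys where xs: "xs = x # ys" "length ys = k" by (auto simp: length_Suc_conv)
  have "tproj B t xs = (\<Sum>b\<in>B. inner x b * tproj B (\<lambda>zs. t (b # zs)) ys)"
    unfolding tproj_def xs
    using linear_onb_expansion[OF multilinear_linear_head[OF Suc.prems(1), of "map (onb_proj B) ys"]] xs(2)
    by simp
  also have "\<dots> = (\<Sum>b\<in>B. inner x b * (\<Sum>bs\<in>tuples B k. t (b # bs) * (\<Prod>i<k. inner (bs ! i) (ys ! i))))"
    using Suc.IH[OF multilinear_Cons[OF Suc.prems(1)] xs(2)] by simp
  also have "\<dots> = (\<Sum>b\<in>B. \<Sum>bs\<in>tuples B k. t (b # bs) * (\<Prod>i<Suc k. inner ((b # bs) ! i) (xs ! i)))"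
    by (simp add: xs prod.lessThan_Suc_shift sum_distrib_left inner_commute mult_ac del: prod.lessThan_Suc)
  also have "\<dots> = (\<Sum>bs\<in>tuples B (Suc k). t bs * (\<Prod>i<Suc k. inner (bs ! i) (xs ! i)))"
    by (simp only: sum_tuples_Suc[OF assms(2)])
  finally show ?case .
qed

lemma multilinear_zero:
  assumes "multilinear k t" "length xs = k" "0 \<in> set xs"
  shows "t xs = 0"
proof -
  from assms(3) obtain i where i: "i < length xs" "xs ! i = 0" by (auto simp: in_set_conv_nth)
  then have "linear (\<lambda>x. t (xs[i := x]))" using assms by (simp add: multilinear_def)
  from linear_0[OF this] show ?thesis using i by (metis list_update_id)
qed

lemma tensor_norm_square:
  fixes t :: "'h::{real_inner, complete_space} tensor"
  assumes "t \<in> tensor_space k"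
  shows "(tensor_norm k t)\<^sup>2 = (SUP B \<in> Collect finite_orthonormal. hs_sum k t B)"
    and "finite_orthonormal B \<Longrightarrow> hs_sum k t B \<le> (tensor_norm k t)\<^sup>2"
proof -
  have bdd: "bdd_above (hs_sum k t ` Collect finite_orthonormal)"
    using assms by (simp add: tensor_space_def)
  have le: "hs_sum k t B \<le> (SUP B \<in> Collect finite_orthonormal. hs_sum k t B)" if "finite_orthonormal B" for B
    using that by (intro cSUP_upper bdd) auto
  have "0 \<le> hs_sum k t {}" by (simp add: hs_sum_def sum_nonneg)
  also have "\<dots> \<le> (SUP B \<in> Collect finite_orthonormal. hs_sum k t B)"
    by (rule le) (simp add: finite_orthonormal_def)
  finally show eq: "(tensor_norm k t)\<^sup>2 = (SUP B \<in> Collect finite_orthonormal. hs_sum k t B)"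
    by (simp add: tensor_norm_def)
  show "hs_sum k t B \<le> (tensor_norm k t)\<^sup>2" if "finite_orthonormal B"
    unfolding eq by (rule le[OF that])
qed

text \<open>
  Pythagoras for the compression of a tensor to the span of \<open>B\<close>. It is checked on a finite
  orthonormal set that extends \<open>B\<close>, where compression just annihilates the tuples not from \<open>B\<close>.
\<close>

lemma tensor_norm_diff_tproj:
  fixes t :: "'h::{real_inner, complete_space} tensor"
  assumes t: "t \<in> tensor_space k" and B: "finite_orthonormal B"
    and diff: "(\<lambda>xs. t xs - tproj B t xs) \<in> tensor_space k"
  shows "(tensor_norm k (\<lambda>xs. t xs - tproj B t xs))\<^sup>2 \<le> (tensor_norm k t)\<^sup>2 - hs_sum k t B"
  unfolding tensor_norm_square(1)[OF diff]
proof (rule cSUP_least)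
  show "Collect finite_orthonormal \<noteq> ({} :: 'h set set)"
    using B by auto
  fix C :: "'h set" assume "C \<in> Collect finite_orthonormal"
  then have C: "finite_orthonormal C" by simp
  obtain B' where B': "B \<subseteq> B'" "finite_orthonormal B'" "\<And>c. c \<in> C \<Longrightarrow> onb_proj B' c = c"
    using gram_schmidt_extension[OF finite_orthonormalD(1)[OF C] B] by auto
  have ml: "multilinear k t" using t by (simp add: tensor_space_def)
  have sub: "tuples B k \<subseteq> tuples B' k" using B'(1) by (auto simp: tuples_def)
  have fin: "finite (tuples B' k)" by (rule finite_tuples[OF finite_orthonormalD(1)[OF B'(2)]])
  have "hs_sum k (\<lambda>xs. t xs - tproj B t xs) C \<le> hs_sum k (\<lambda>xs. t xs - tproj B t xs) B'"
    using diff by (intro hs_sum_mono C B') (auto simp: tensor_space_def)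
  also have "\<dots> = (\<Sum>bs\<in>tuples B' k. if bs \<in> tuples B k then 0 else (t bs)\<^sup>2)"
    unfolding hs_sum_tuples
  proof (intro sum.cong refl)
    fix bs assume bs: "bs \<in> tuples B' k"
    show "(t bs - tproj B t bs)\<^sup>2 = (if bs \<in> tuples B k then 0 else (t bs)\<^sup>2)"
    proof (cases "bs \<in> tuples B k")
      case True
      then show ?thesis using tproj_tuples[OF B True] by simp
    next
      case False
      then obtain b where b: "b \<in> set bs" "b \<notin> B" using bs by (auto simp: tuples_def)
      then have "b \<in> B'" using bs by (auto simp: tuples_def)
      then have "onb_proj B b = 0"
        unfolding onb_proj_def using b B' finite_orthonormalD(2)[OF B'(2), of b] by (intro sum.neutral) auto
      then have "0 \<in> set (map (onb_proj B) bs)" using b(1) by force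
      then have "tproj B t bs = 0"
        unfolding tproj_def using bs by (intro multilinear_zero[OF ml]) (auto simp: tuples_def)
      then show ?thesis using False by simp
    qed
  qed
  also have "\<dots> = (\<Sum>bs\<in>tuples B' k - tuples B k. (t bs)\<^sup>2)"
    by (rule sum.mono_neutral_cong_right) (use fin in auto)
  also have "\<dots> = hs_sum k t B' - hs_sum k t B"
    unfolding hs_sum_tuples using sub fin by (subst sum_diff) auto
  also have "\<dots> \<le> (tensor_norm k t)\<^sup>2 - hs_sum k t B"
    using tensor_norm_square(2)[OF t B'(2)] by simp
  finally show "hs_sum k (\<lambda>xs. t xs - tproj B t xs) C \<le> (tensor_norm k t)\<^sup>2 - hs_sum k t B" .
qed

section \<open>Symmetric tensors of finite rank\<close>

lemma tensor_pow_prod: "tensor_pow k h xs = (if length xs = k then \<Prod>i<k. inner h (xs ! i) else 0)"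
  by (simp add: tensor_pow_def prod.list_conv_set_nth atLeast0LessThan)

lemma sum_tensor_pow:
  assumes "finite B"
  shows "(\<Sum>bs\<in>tuples B k. tensor_pow k g bs * tensor_pow k h bs) = (\<Sum>b\<in>B. inner g b * inner h b) ^ k"
proof (induction k)
  case 0
  then show ?case by (simp add: sum_tuples_0 tensor_pow_def)
next
  case (Suc k)
  have "tensor_pow (Suc k) u (b # bs) = inner u b * tensor_pow k u bs" for u b and bs :: "'a list"
    by (simp add: tensor_pow_def)
  then have "(\<Sum>bs\<in>tuples B (Suc k). tensor_pow (Suc k) g bs * tensor_pow (Suc k) h bs) =
      (\<Sum>b\<in>B. \<Sum>bs\<in>tuples B k. (inner g b * inner h b) * (tensor_pow k g bs * tensor_pow k h bs))"
    by (simp add: sum_tuples_Suc[OF assms] mult_ac)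
  also have "\<dots> = (\<Sum>b\<in>B. inner g b * inner h b) * (\<Sum>b\<in>B. inner g b * inner h b) ^ k"
    by (simp add: sum_distrib_left[symmetric] sum_distrib_right[symmetric] Suc.IH)
  finally show ?case by simp
qed

lemma tensor_pow_sym_tensor: "tensor_pow k (h :: 'h::{real_inner, complete_space}) \<in> sym_tensor_space k"
proof -
  have "linear (\<lambda>x. tensor_pow k h (xs[i := x]))" if "length xs = k" "i < k" for xs i
  proof -
    have "tensor_pow k h (xs[i := x]) = inner h x * (\<Prod>j\<in>{..<k} - {i}. inner h (xs ! j))" for x
    proof -
      have "tensor_pow k h (xs[i := x]) = (\<Prod>j<k. inner h (xs[i := x] ! j))"
        using that by (simp add: tensor_pow_prod)
      also have "\<dots> = inner h (xs[i := x] ! i) * (\<Prod>j\<in>{..<k} - {i}. inner h (xs[i := x] ! j))"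
        using that by (intro prod.remove) auto
      also have "(\<Prod>j\<in>{..<k} - {i}. inner h (xs[i := x] ! j)) = (\<Prod>j\<in>{..<k} - {i}. inner h (xs ! j))"
        by (intro prod.cong) auto
      finally show ?thesis using that by simp
    qed
    then show ?thesis by (intro linearI) (auto simp: inner_add_right algebra_simps)
  qed
  moreover have "bdd_above (hs_sum k (tensor_pow k h) ` Collect finite_orthonormal)"
  proof (rule bdd_aboveI2)
    fix B :: "'h set" assume "B \<in> Collect finite_orthonormal"
    then have B: "finite_orthonormal B" by simp
    have "hs_sum k (tensor_pow k h) B = (\<Sum>b\<in>B. (inner h b)\<^sup>2) ^ k"
      using sum_tensor_pow[OF finite_orthonormalD(1)[OF B], of k h h]
      by (simp add: hs_sum_tuples power2_eq_square)
    also have "\<dots> \<le> ((norm h)\<^sup>2) ^ k"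
      by (intro power_mono bessel_inequality[OF B] sum_nonneg) auto
    finally show "hs_sum k (tensor_pow k h) B \<le> ((norm h)\<^sup>2) ^ k" .
  qed
  moreover have "tensor_pow k h (permute_list \<pi> xs) = tensor_pow k h xs"
    if "length xs = k" "\<pi> permutes {..<k}" for xs \<pi>
  proof -
    have "mset (map (inner h) (permute_list \<pi> xs)) = mset (map (inner h) xs)"
      using that by simp
    then have "prod_list (map (inner h) (permute_list \<pi> xs)) = prod_list (map (inner h) xs)"
      by (metis prod_mset_prod_list)
    then show ?thesis using that by (simp add: tensor_pow_def)
  qed
  ultimately show ?thesis
    by (auto simp: sym_tensor_space_def tensor_space_def multilinear_def tensor_pow_def)
qed

lemma sym_tensor_lincomb:
  fixes f g :: "'h::{real_inner, complete_space} tensor"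
  assumes f: "f \<in> sym_tensor_space k" and g: "g \<in> sym_tensor_space k"
  shows "(\<lambda>xs. a * f xs + b * g xs) \<in> sym_tensor_space k"
proof -
  have ft: "f \<in> tensor_space k" and gt: "g \<in> tensor_space k"
    using f g by (auto simp: sym_tensor_space_def)
  have lin: "linear (\<lambda>x. a * \<phi> x + b * \<psi> x)" if "linear \<phi>" "linear \<psi>" for \<phi> \<psi> :: "'h \<Rightarrow> real"
    using that by (intro linearI) (simp_all add: linear_add linear_scale algebra_simps)
  have "multilinear k (\<lambda>xs. a * f xs + b * g xs)"
    using ft gt unfolding tensor_space_def multilinear_def by (auto intro: lin)
  moreover have "bdd_above (hs_sum k (\<lambda>xs. a * f xs + b * g xs) ` Collect finite_orthonormal)"
  proof (rule bdd_aboveI2)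
    fix B :: "'h set" assume "B \<in> Collect finite_orthonormal"
    then have B: "finite_orthonormal B" by simp
    have *: "(a * x + b * y)\<^sup>2 \<le> 2 * a\<^sup>2 * x\<^sup>2 + 2 * b\<^sup>2 * y\<^sup>2" for x y
      using zero_le_power2[of "a * x - b * y"] by (simp add: power2_eq_square algebra_simps)
    have "hs_sum k (\<lambda>xs. a * f xs + b * g xs) B \<le> (\<Sum>bs\<in>tuples B k. 2 * a\<^sup>2 * (f bs)\<^sup>2 + 2 * b\<^sup>2 * (g bs)\<^sup>2)"
      unfolding hs_sum_tuples by (intro sum_mono *)
    also have "\<dots> = 2 * a\<^sup>2 * hs_sum k f B + 2 * b\<^sup>2 * hs_sum k g B"
      by (simp add: hs_sum_tuples sum.distrib sum_distrib_left)
    also have "\<dots> \<le> 2 * a\<^sup>2 * (tensor_norm k f)\<^sup>2 + 2 * b\<^sup>2 * (tensor_norm k g)\<^sup>2"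
      using tensor_norm_square(2)[OF ft B] tensor_norm_square(2)[OF gt B]
      by (intro add_mono mult_left_mono) auto
    finally show "hs_sum k (\<lambda>xs. a * f xs + b * g xs) B \<le>
      2 * a\<^sup>2 * (tensor_norm k f)\<^sup>2 + 2 * b\<^sup>2 * (tensor_norm k g)\<^sup>2" .
  qed
  ultimately show ?thesis
    using f g by (auto simp: sym_tensor_space_def tensor_space_def)
qed

lemma sym_tensor_zero: "(\<lambda>xs. 0) \<in> sym_tensor_space k"
  using sym_tensor_lincomb[OF tensor_pow_sym_tensor tensor_pow_sym_tensor, of 0 k undefined 0 undefined] by simp

lemma sym_tensor_sum_tensor_pow:
  "(\<lambda>xs. \<Sum>a\<in>A. c a * tensor_pow k (h a) xs) \<in> sym_tensor_space k"
proof (induction A rule: infinite_finite_induct)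
  case (insert a A)
  then show ?case
    using sym_tensor_lincomb[OF tensor_pow_sym_tensor insert.IH, of "c a" "h a" 1] by simp
qed (simp_all add: sym_tensor_zero)

text \<open>
  The compression of a symmetric tensor is a linear combination of tensor powers: symmetrize the
  expansion of the tensor along the basis, and polarize the symmetrized elementary tensors.
\<close>

lemma tproj_sym_tensor:
  fixes f :: "'h::{real_inner, complete_space} tensor"
  assumes f: "f \<in> sym_tensor_space k" and B: "finite B"
  shows "tproj B f = (\<lambda>xs. \<Sum>(bs, S)\<in>tuples B k \<times> Pow {..<k}.
    (f bs * (-1) ^ card ({..<k} - S) / fact k) * tensor_pow k (\<Sum>j\<in>S. bs ! j) xs)"
proof
  fix xs
  show "tproj B f xs = (\<Sum>(bs, S)\<in>tuples B k \<times> Pow {..<k}.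
    (f bs * (-1) ^ card ({..<k} - S) / fact k) * tensor_pow k (\<Sum>j\<in>S. bs ! j) xs)"
  proof (cases "length xs = k")
    case False
    have "f (map (onb_proj B) xs) = 0"
      using f False by (auto simp: sym_tensor_space_def tensor_space_def)
    then show ?thesis using False by (simp add: tproj_def tensor_pow_def)
  next
    case True
    have ml: "multilinear k f" using f by (simp add: sym_tensor_space_def tensor_space_def)
    have perm: "tproj B f xs = (\<Sum>bs\<in>tuples B k. f bs * (\<Prod>i<k. inner (bs ! \<pi> i) (xs ! i)))"
      if \<pi>: "\<pi> permutes {..<k}" for \<pi>
    proof -
      have "(\<Sum>bs\<in>tuples B k. f bs * (\<Prod>i<k. inner (bs ! \<pi> i) (xs ! i))) =
          (\<Sum>bs\<in>tuples B k. f bs * (\<Prod>i<k. inner (bs ! i) (xs ! i)))"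
      proof (rule sum.reindex_bij_witness[where j = "permute_list \<pi>" and i = "permute_list (inv \<pi>)"])
        fix bs assume bs: "bs \<in> tuples B k"
        then have len: "length bs = k" by (simp add: tuples_def)
        have inv: "inv \<pi> permutes {..<k}" using \<pi> by (rule permutes_inv)
        show "permute_list (inv \<pi>) (permute_list \<pi> bs) = bs" "permute_list \<pi> (permute_list (inv \<pi>) bs) = bs"
          using permute_list_compose[of "inv \<pi>" bs \<pi>] permute_list_compose[of \<pi> bs "inv \<pi>"]
            permutes_inv_o[OF \<pi>] \<pi> inv len by auto
        show "permute_list \<pi> bs \<in> tuples B k" "permute_list (inv \<pi>) bs \<in> tuples B k"
          using bs \<pi> inv by (auto simp: tuples_def)
        have "f (permute_list \<pi> bs) = f bs"
          using f \<pi> len by (auto simp: sym_tensor_space_def)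
        moreover have "(\<Prod>i<k. inner (permute_list \<pi> bs ! i) (xs ! i)) = (\<Prod>i<k. inner (bs ! \<pi> i) (xs ! i))"
          using \<pi> len by (intro prod.cong) (auto simp: permute_list_nth)
        ultimately show "f (permute_list \<pi> bs) * (\<Prod>i<k. inner (permute_list \<pi> bs ! i) (xs ! i)) =
            f bs * (\<Prod>i<k. inner (bs ! \<pi> i) (xs ! i))" by simp
      qed
      then show ?thesis using tproj_expansion[OF ml B True] by simp
    qed
    have "fact k * tproj B f xs = (\<Sum>\<pi> | \<pi> permutes {..<k}. tproj B f xs)"
      by (simp add: card_permutations[of _ k])
    also have "\<dots> = (\<Sum>\<pi> | \<pi> permutes {..<k}. \<Sum>bs\<in>tuples B k. f bs * (\<Prod>i<k. inner (bs ! \<pi> i) (xs ! i)))"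
      using perm by (intro sum.cong) auto
    also have "\<dots> = (\<Sum>bs\<in>tuples B k. f bs * (\<Sum>\<pi> | \<pi> permutes {..<k}. \<Prod>i<k. inner (bs ! \<pi> i) (xs ! i)))"
      unfolding sum_distrib_left by (rule sum.swap)
    also have "\<dots> = (\<Sum>bs\<in>tuples B k. f bs *
        (\<Sum>S\<in>Pow {..<k}. (-1) ^ card ({..<k} - S) * (\<Prod>i<k. \<Sum>j\<in>S. inner (bs ! j) (xs ! i))))"
      unfolding ryser_permanent[where a = "\<lambda>j i. inner (_ ! j) (xs ! i)"] ..
    also have "\<dots> = fact k * (\<Sum>bs\<in>tuples B k. \<Sum>S\<in>Pow {..<k}.
        (f bs * (-1) ^ card ({..<k} - S) / fact k) * tensor_pow k (\<Sum>j\<in>S. bs ! j) xs)"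
      using True by (simp add: tensor_pow_prod inner_sum_left sum_distrib_left mult_ac)
    finally show ?thesis by (simp add: sum.cartesian_product)
  qed
qed

lemma tproj_in_sym_tensor_space:
  fixes f :: "'h::{real_inner, complete_space} tensor"
  assumes "f \<in> sym_tensor_space k" "finite B"
  shows "tproj B f \<in> sym_tensor_space k"
  unfolding tproj_sym_tensor[OF assms]
  using sym_tensor_sum_tensor_pow[of "\<lambda>(bs, S). f bs * (-1) ^ card ({..<k} - S) / fact k"
      k "\<lambda>(bs, S). \<Sum>j\<in>S. bs ! j"]
  by (simp add: case_prod_beta)

section \<open>Multiple integrals of finite-rank tensors\<close>

lemma poly_hermite: "poly (hermite k) y = hermite_var 1 k y"
proof (induction k arbitrary: y)
  case (Suc k)
  have "poly (hermite k) = hermite_var 1 k" by (rule ext) (rule Suc.IH)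
  then have "(hermite_var 1 k has_real_derivative poly (pderiv (hermite k)) y) (at y)"
    using poly_DERIV[of "hermite k" y] by simp
  then have "poly (pderiv (hermite k)) y = real k * hermite_var 1 (k - 1) y"
    by (rule DERIV_unique[OF _ hermite_var_deriv])
  then show ?case using Suc.IH by simp
qed simp

lemma hermite_var_scale: "hermite_var (\<sigma>\<^sup>2) k (\<sigma> * y) = \<sigma> ^ k * hermite_var 1 k y"
proof (induction "1::real" k y rule: hermite_var.induct)
  case (2 k y)
  show ?case
  proof (cases k)
    case (Suc j)
    have IH: "hermite_var (\<sigma>\<^sup>2) k (\<sigma> * y) = \<sigma> ^ k * hermite_var 1 k y"
      "hermite_var (\<sigma>\<^sup>2) j (\<sigma> * y) = \<sigma> ^ j * hermite_var 1 j y"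
      using 2 Suc by simp_all
    have k1: "k - 1 = j" using Suc by simp
    have "hermite_var (\<sigma>\<^sup>2) (Suc k) (\<sigma> * y) =
        \<sigma> * y * (\<sigma> ^ k * hermite_var 1 k y) - real k * \<sigma>\<^sup>2 * (\<sigma> ^ j * hermite_var 1 j y)"
      by (simp only: hermite_var.simps(2)[of _ k] IH k1)
    also have "\<dots> = \<sigma> ^ Suc k * (y * hermite_var 1 k y - real k * 1 * hermite_var 1 j y)"
      by (simp add: Suc algebra_simps power2_eq_square del: hermite_var.simps)
    also have "\<dots> = \<sigma> ^ Suc k * hermite_var 1 (Suc k) y"
      by (simp only: hermite_var.simps(2)[of _ k] k1)
    finally show ?thesis .
  qed simp
qed simp

context gaussian_functional
begin

lemma L_wick_wick:
  "L (\<lambda>x. wick g k x * wick h k x) = fact k * (\<Sum>b\<in>B. inner g b * inner h b) ^ k"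
proof (induction k)
  case 0
  then show ?case by (simp add: wick_0)
next
  case (Suc k)
  have "L (\<lambda>x. wick g k x * dirD b (wick h (Suc k)) x) =
      real (Suc k) * inner h b * (fact k * (\<Sum>b\<in>B. inner g b * inner h b) ^ k)" for b
  proof -
    have "(\<lambda>x. wick g k x * dirD b (wick h (Suc k)) x) =
        (\<lambda>x. (real (Suc k) * inner h b) * (wick g k x * wick h k x))"
      by (simp add: dirD_wick mult_ac)
    then show ?thesis
      using L_scale[OF polyfun_mult[OF wick_polyfun[of g k] wick_polyfun[of h k]]] Suc.IH by simp
  qed
  then have "L (\<lambda>x. wick g (Suc k) x * wick h (Suc k) x) =
      (\<Sum>b\<in>B. (inner g b * inner h b) * (fact (Suc k) * (\<Sum>b\<in>B. inner g b * inner h b) ^ k))"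
    unfolding L_wick_Suc[OF wick_polyfun] by (simp add: mult_ac)
  also have "\<dots> = (\<Sum>b\<in>B. inner g b * inner h b) * (fact (Suc k) * (\<Sum>b\<in>B. inner g b * inner h b) ^ k)"
    by (rule sum_distrib_right[symmetric])
  finally show ?case by (simp only: power_Suc mult_ac)
qed

lemma pairing_lincomb_left:
  assumes "\<And>a. a \<in> A \<Longrightarrow> p a \<in> polyfun n"
  shows "deriv_pairing B L m (\<lambda>x. \<Sum>a\<in>A. c a * p a x) q = (\<Sum>a\<in>A. c a * deriv_pairing B L m (p a) q)"
  using assms
proof (induction A rule: infinite_finite_induct)
  case (insert a A)
  have 1: "(\<lambda>x. c a * p a x) \<in> polyfun n" and 2: "(\<lambda>x. \<Sum>a\<in>A. c a * p a x) \<in> polyfun n"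
    using insert.prems by (auto intro!: polyfun.scale polyfun_sum)
  have IH: "deriv_pairing B L m (\<lambda>x. \<Sum>a\<in>A. c a * p a x) q = (\<Sum>a\<in>A. c a * deriv_pairing B L m (p a) q)"
    using insert.prems by (intro insert.IH) auto
  have "deriv_pairing B L m (\<lambda>x. c a * p a x) q = c a * deriv_pairing B L m (p a) q"
    using insert.prems by (intro pairing_scale_left[of _ n]) auto
  then show ?case using pairing_add_left[OF 1 2] insert.hyps IH by simp
qed simp_all

lemma pairing_wick_sum:
  fixes c :: "'i \<Rightarrow> real" and h :: "'i \<Rightarrow> 'a" and k :: nat and A :: "'i set"
  defines "F \<equiv> \<lambda>x. \<Sum>a\<in>A. c a * wick (h a) k x"
  shows "deriv_pairing B L m F F =
    (if m = k then fact k * (\<Sum>bs\<in>tuples B k. (\<Sum>a\<in>A. c a * tensor_pow k (h a) bs)\<^sup>2) else 0)"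
proof -
  have ww: "deriv_pairing B L m (wick (h a) k) (wick (h a') k) =
      (if m = k then fact k * (\<Sum>b\<in>B. inner (h a) b * inner (h a') b) ^ k else 0)" for a a'
    by (simp add: pairing_wick[OF wick_polyfun] L_wick_wick)
  have "deriv_pairing B L m F F = (\<Sum>a\<in>A. c a * deriv_pairing B L m (wick (h a) k) F)"
    unfolding F_def by (rule pairing_lincomb_left[OF wick_polyfun])
  also have "\<dots> = (\<Sum>a\<in>A. c a * (\<Sum>a'\<in>A. c a' * deriv_pairing B L m (wick (h a') k) (wick (h a) k)))"
    unfolding deriv_pairing_sym[of B L m "wick _ k" F]
    unfolding F_def by (simp add: pairing_lincomb_left[OF wick_polyfun])
  finally have eq: "deriv_pairing B L m F F =
      (\<Sum>a\<in>A. c a * (\<Sum>a'\<in>A. c a' * deriv_pairing B L m (wick (h a') k) (wick (h a) k)))" .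
  show ?thesis
  proof (cases "m = k")
    case True
    have "(\<Sum>bs\<in>tuples B k. (\<Sum>a\<in>A. c a * tensor_pow k (h a) bs)\<^sup>2) =
        (\<Sum>bs\<in>tuples B k. \<Sum>a\<in>A. \<Sum>a'\<in>A. c a * c a' * (tensor_pow k (h a') bs * tensor_pow k (h a) bs))"
      by (simp add: power2_eq_square sum_product mult_ac)
    also have "\<dots> = (\<Sum>a\<in>A. \<Sum>bs\<in>tuples B k. \<Sum>a'\<in>A. c a * c a' * (tensor_pow k (h a') bs * tensor_pow k (h a) bs))"
      by (rule sum.swap)
    also have "\<dots> = (\<Sum>a\<in>A. \<Sum>a'\<in>A. \<Sum>bs\<in>tuples B k. c a * c a' * (tensor_pow k (h a') bs * tensor_pow k (h a) bs))"
      by (intro sum.cong refl sum.swap)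
    also have "\<dots> = (\<Sum>a\<in>A. \<Sum>a'\<in>A. c a * c a' * (\<Sum>b\<in>B. inner (h a') b * inner (h a) b) ^ k)"
      by (simp add: sum_distrib_left[symmetric] sum_tensor_pow[OF finite_B])
    finally show ?thesis
      unfolding eq ww using True by (simp add: sum_distrib_left mult_ac)
  next
    case False
    then show ?thesis unfolding eq ww by simp
  qed
qed

end

context isonormal_gaussian_process
begin

lemma multiple_integral_lincomb:
  assumes I: "multiple_integral M X k I" and "finite A"
  shows "AE \<omega> in M. I (\<lambda>xs. \<Sum>a\<in>A. c a * tensor_pow k (h a) xs) \<omega> =
    (\<Sum>a\<in>A. c a * I (tensor_pow k (h a)) \<omega>)"
proof -
  have lin: "AE \<omega> in M. I (\<lambda>xs. a * f xs + b * g xs) \<omega> = a * I f \<omega> + b * I g \<omega>"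
    if "f \<in> sym_tensor_space k" "g \<in> sym_tensor_space k" for f g a b
    using I that unfolding multiple_integral_def by blast
  show ?thesis using assms(2)
  proof (induction A rule: finite_induct)
    case empty
    then show ?case using lin[OF sym_tensor_zero sym_tensor_zero, of 0 0] by simp
  next
    case (insert a A)
    show ?case
      using lin[OF tensor_pow_sym_tensor sym_tensor_sum_tensor_pow, of "c a" "h a" 1 c h A] insert by auto
  qed
qed

text \<open>
  The defining property of the multiple integral determines it on powers of unit vectors only; the
  Hermite polynomials whose variance is a parameter make the formula homogeneous in \<open>h\<close>.
\<close>

lemma multiple_integral_tensor_pow:
  assumes I: "multiple_integral M X k I" and k: "1 \<le> k"
  shows "AE \<omega> in M. I (tensor_pow k h) \<omega> = hermite_var ((norm h)\<^sup>2) k (X h \<omega>)"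
proof (cases "h = 0")
  case True
  obtain j where j: "k = Suc j" using k by (cases k) auto
  have "tensor_pow k h = (\<lambda>xs. 0)"
    using k True by (auto simp: tensor_pow_prod fun_eq_iff)
  moreover have "hermite_var 0 k 0 = 0" by (simp add: j)
  ultimately show ?thesis
    using multiple_integral_lincomb[OF I, of "{}"] X_zero True by auto
next
  case False
  define u where "u = h /\<^sub>R norm h"
  have u: "norm u = 1" "h = norm h *\<^sub>R u" using False by (simp_all add: u_def)
  have "tensor_pow k h = (\<lambda>xs. \<Sum>a\<in>{()}. norm h ^ k * tensor_pow k u xs)"
    by (subst u(2)) (auto simp: tensor_pow_prod fun_eq_iff prod.distrib)
  then have "AE \<omega> in M. I (tensor_pow k h) \<omega> = norm h ^ k * I (tensor_pow k u) \<omega>"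
    using multiple_integral_lincomb[OF I, of "{()}" "\<lambda>_. norm h ^ k" "\<lambda>_. u"] by simp
  moreover have "AE \<omega> in M. I (tensor_pow k u) \<omega> = poly (hermite k) (X u \<omega>)"
    using I u(1) unfolding multiple_integral_def by blast
  moreover have "AE \<omega> in M. X h \<omega> = norm h * X u \<omega>"
    using X_scale[of "norm h" u, folded u(2)] .
  ultimately show ?thesis
    by eventually_elim (simp add: poly_hermite hermite_var_scale)
qed

text \<open>
  The multiple integral of the compression of \<open>f\<close> to the span of \<open>B\<close> is a polynomial in the
  process. It lies in the chaos of order \<open>k\<close>, so its second moment and the Fischer norm of its
  leading part agree.
\<close>

lemma multiple_integral_tproj:
  assumes I: "multiple_integral M X k I" and k: "1 \<le> k"
    and f: "f \<in> sym_tensor_space k" and B: "finite_orthonormal B"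
  obtains F where "F \<in> polyfun k" "AE \<omega> in M. I (tproj B f) \<omega> = F (gvec B \<omega>)"
    "gexp B (\<lambda>x. F x * F x) = fact k * hs_sum k f B"
    "deriv_pairing B (\<lambda>p. p 0) k F F = fact k * hs_sum k f B"
proof -
  interpret gaussian_functional B "gexp B" by (rule gaussian_functional_gexp[OF B])
  define A where "A = tuples B k \<times> Pow {..<k}"
  define c where "c = (\<lambda>(bs, S). f bs * (-1) ^ card ({..<k} - S) / fact k)"
  define h :: "'h list \<times> nat set \<Rightarrow> 'h" where "h = (\<lambda>(bs, S). \<Sum>j\<in>S. bs ! j)"
  define F where "F = (\<lambda>x. \<Sum>a\<in>A. c a * wick (h a) k x)"
  have finA: "finite A" using finite_B by (simp add: A_def finite_tuples)
  have tp: "tproj B f = (\<lambda>xs. \<Sum>a\<in>A. c a * tensor_pow k (h a) xs)"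
    unfolding tproj_sym_tensor[OF f finite_B] A_def c_def h_def by (simp add: case_prod_beta)
  have hB: "onb_proj B (h a) = h a" if "a \<in> A" for a
  proof -
    obtain bs S where a: "a = (bs, S)" by (cases a)
    then have bsS: "length bs = k" "set bs \<subseteq> B" "S \<subseteq> {..<k}"
      using that by (auto simp: A_def tuples_def)
    have "bs ! j \<in> B" if "j \<in> S" for j
    proof -
      have "j < length bs" using bsS that by auto
      from nth_mem[OF this] show ?thesis using bsS by auto
    qed
    then have "onb_proj B (bs ! j) = bs ! j" if "j \<in> S" for j
      using that by (intro onb_proj_basis[OF B])
    then show ?thesis by (simp add: a h_def linear_sum[OF linear_onb_proj])
  qed
  have F: "F \<in> polyfun k"
    unfolding F_def by (intro polyfun_sum polyfun.scale wick_polyfun)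
  have ae_pow: "AE \<omega> in M. I (tensor_pow k (h a)) \<omega> = wick (h a) k (gvec B \<omega>)" if a: "a \<in> A" for a
  proof -
    have "(norm (h a))\<^sup>2 = inner (onb_proj B (h a)) (h a)"
      using hB[OF a] by (simp add: power2_norm_eq_inner)
    also have "\<dots> = (\<Sum>b\<in>B. (inner (h a) b)\<^sup>2)"
      unfolding inner_onb_proj_left by (simp add: power2_eq_square inner_commute[of _ "h a"])
    finally have "(norm (h a))\<^sup>2 = (\<Sum>b\<in>B. (inner (h a) b)\<^sup>2)" .
    then show ?thesis
      using multiple_integral_tensor_pow[OF I k, of "h a"] inner_gvec_AE[OF finite_B, of "h a"] hB[OF a]
      by (auto simp: wick_def)
  qed
  have "AE \<omega> in M. \<forall>a\<in>A. I (tensor_pow k (h a)) \<omega> = wick (h a) k (gvec B \<omega>)"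
    by (rule AE_finite_allI[OF finA]) (rule ae_pow)
  then have ae: "AE \<omega> in M. I (tproj B f) \<omega> = F (gvec B \<omega>)"
    using multiple_integral_lincomb[OF I finA, of c h] by (auto simp: F_def tp)
  have hs: "(\<Sum>bs\<in>tuples B k. (\<Sum>a\<in>A. c a * tensor_pow k (h a) bs)\<^sup>2) = hs_sum k f B"
    unfolding hs_sum_tuples using tproj_tuples[OF B, of _ k f] by (intro sum.cong refl) (simp add: tp)
  have pair: "deriv_pairing B (gexp B) m F F = (if m = k then fact k * hs_sum k f B else 0)" for m
    unfolding F_def by (simp add: pairing_wick_sum hs)
  have "gexp B (\<lambda>x. F x * F x) = fact k * hs_sum k f B"
    using chaos_decomposition[OF F F order_refl] pair by simp
  moreover have "deriv_pairing B (\<lambda>p. p 0) k F F = fact k * hs_sum k f B"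
    using pairing_top_degree[OF F F] pair by simp
  ultimately show thesis using that F ae by blast
qed

text \<open>
  The inequality for tensors of finite rank: the second moment of the product is at least the
  Fischer norm of its leading part, to which Bombieri's inequality applies. The bound on the
  fourth moment of the product is uniform in \<open>B\<close>.
\<close>

lemma finite_rank_product:
  fixes J :: "'i \<Rightarrow> 'h tensor \<Rightarrow> 'a \<Rightarrow> real"
  assumes A: "finite A" and I: "\<And>i. i \<in> A \<Longrightarrow> multiple_integral M X (k i) (J i)"
    and k: "\<And>i. i \<in> A \<Longrightarrow> 1 \<le> k i" and f: "\<And>i. i \<in> A \<Longrightarrow> f i \<in> sym_tensor_space (k i)"
    and B: "finite_orthonormal B"
  defines "Y \<equiv> \<lambda>\<omega>. \<Prod>i\<in>A. (J i (tproj B (f i)) \<omega>)\<^sup>2" and "n \<equiv> \<Sum>i\<in>A. k i"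
  shows "integrable M Y" "integrable M (\<lambda>\<omega>. (Y \<omega>)\<^sup>2)"
    "expectation (\<lambda>\<omega>. (Y \<omega>)\<^sup>2) \<le> product_const n *
      (product_const n ^ card A * (\<Prod>i\<in>A. fact (k i) * (tensor_norm (k i) (f i))\<^sup>2))\<^sup>2"
    "(\<Prod>i\<in>A. fact (k i) * hs_sum (k i) (f i) B) \<le> expectation Y"
    "A = {i} \<Longrightarrow> expectation Y = fact (k i) * hs_sum (k i) (f i) B"
proof -
  interpret gaussian_functional B "gexp B" by (rule gaussian_functional_gexp[OF B])
  have ex: "\<exists>F. F \<in> polyfun (k i) \<and> (AE \<omega> in M. J i (tproj B (f i)) \<omega> = F (gvec B \<omega>)) \<and>
    gexp B (\<lambda>x. F x * F x) = fact (k i) * hs_sum (k i) (f i) B \<and>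
    deriv_pairing B (\<lambda>p. p 0) (k i) F F = fact (k i) * hs_sum (k i) (f i) B" if "i \<in> A" for i
    by (rule multiple_integral_tproj[OF I[OF that] k[OF that] f[OF that] B]) blast
  have "\<exists>F. \<forall>i\<in>A. F i \<in> polyfun (k i) \<and> (AE \<omega> in M. J i (tproj B (f i)) \<omega> = F i (gvec B \<omega>)) \<and>
    gexp B (\<lambda>x. F i x * F i x) = fact (k i) * hs_sum (k i) (f i) B \<and>
    deriv_pairing B (\<lambda>p. p 0) (k i) (F i) (F i) = fact (k i) * hs_sum (k i) (f i) B"
    by (rule bchoice, rule ballI, rule ex)
  then obtain F where F: "\<And>i. i \<in> A \<Longrightarrow> F i \<in> polyfun (k i)"
    "\<And>i. i \<in> A \<Longrightarrow> AE \<omega> in M. J i (tproj B (f i)) \<omega> = F i (gvec B \<omega>)"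
    "\<And>i. i \<in> A \<Longrightarrow> gexp B (\<lambda>x. F i x * F i x) = fact (k i) * hs_sum (k i) (f i) B"
    "\<And>i. i \<in> A \<Longrightarrow> deriv_pairing B (\<lambda>p. p 0) (k i) (F i) (F i) = fact (k i) * hs_sum (k i) (f i) B"
    by blast
  define R where "R = (\<lambda>x. \<Prod>i\<in>A. F i x)"
  have R: "R \<in> polyfun n" unfolding R_def n_def using F(1) by (rule polyfun_prod)
  note RR = polyfun_mult[OF R R]
  have "AE \<omega> in M. \<forall>i\<in>A. J i (tproj B (f i)) \<omega> = F i (gvec B \<omega>)"
    by (rule AE_finite_allI[OF A]) (rule F(2))
  then have ae: "AE \<omega> in M. Y \<omega> = R (gvec B \<omega>) * R (gvec B \<omega>)"
  proof eventually_elim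
    case (elim \<omega>)
    then have "Y \<omega> = (\<Prod>i\<in>A. F i (gvec B \<omega>) * F i (gvec B \<omega>))"
      unfolding Y_def by (intro prod.cong) (auto simp: power2_eq_square)
    then show ?case by (simp add: R_def prod.distrib)
  qed
  have tp: "tproj B (f i) \<in> sym_tensor_space (k i)" if "i \<in> A" for i
    by (rule tproj_in_sym_tensor_space[OF f[OF that] finite_B])
  have "J i (tproj B (f i)) \<in> borel_measurable M" if "i \<in> A" for i
    using I[OF that] tp[OF that] unfolding multiple_integral_def by blast
  then have Y_meas: "Y \<in> borel_measurable M" unfolding Y_def by measurable
  note R_meas = polyfun_gvec_measurable[OF R, of B]
  have YY: "integrable M Y \<longleftrightarrow> integrable M (\<lambda>\<omega>. R (gvec B \<omega>) * R (gvec B \<omega>))"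
    by (rule integrable_cong_AE) (use ae Y_meas R_meas in auto)
  then show "integrable M Y" using polyfun_gvec_integrable[OF finite_B RR] by simp
  have "integrable M (\<lambda>\<omega>. (Y \<omega>)\<^sup>2) \<longleftrightarrow>
      integrable M (\<lambda>\<omega>. (R (gvec B \<omega>) * R (gvec B \<omega>)) * (R (gvec B \<omega>) * R (gvec B \<omega>)))"
    by (rule integrable_cong_AE) (use ae Y_meas R_meas in \<open>auto simp: power2_eq_square\<close>)
  then show "integrable M (\<lambda>\<omega>. (Y \<omega>)\<^sup>2)"
    using polyfun_gvec_integrable[OF finite_B polyfun_mult[OF RR RR]] by simp
  have EY: "expectation Y = gexp B (\<lambda>x. R x * R x)"
    by (rule integral_cong_AE) (use ae Y_meas R_meas in auto)
  have EY2: "expectation (\<lambda>\<omega>. (Y \<omega>)\<^sup>2) = gexp B (\<lambda>x. (R x * R x) * (R x * R x))"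
    by (rule integral_cong_AE) (use ae Y_meas R_meas in \<open>auto simp: power2_eq_square\<close>)
  have hs_nonneg: "0 \<le> hs_sum (k i) (f i) B" for i by (simp add: hs_sum_def sum_nonneg)
  have norm: "hs_sum (k i) (f i) B \<le> (tensor_norm (k i) (f i))\<^sup>2" if "i \<in> A" for i
    using f[OF that] by (intro tensor_norm_square(2)[OF _ B]) (auto simp: sym_tensor_space_def)
  have "gexp B (\<lambda>x. R x * R x) \<le> product_const n ^ card A * (\<Prod>i\<in>A. gexp B (\<lambda>x. F i x * F i x))"
    unfolding R_def
  proof (rule second_moment_prod[OF A, where k = k])
    show "(\<Sum>i\<in>A. k i) \<le> n" unfolding n_def by (rule order_refl)
  qed (rule F(1))
  also have "\<dots> \<le> product_const n ^ card A * (\<Prod>i\<in>A. fact (k i) * (tensor_norm (k i) (f i))\<^sup>2)"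
    by (intro mult_left_mono prod_mono conjI)
       (auto simp: F(3) hs_nonneg norm product_const_nonneg intro!: mult_left_mono)
  finally have bound: "gexp B (\<lambda>x. R x * R x) \<le>
      product_const n ^ card A * (\<Prod>i\<in>A. fact (k i) * (tensor_norm (k i) (f i))\<^sup>2)" .
  have "gexp B (\<lambda>x. (R x * R x) * (R x * R x)) \<le> product_const n * (gexp B (\<lambda>x. R x * R x))\<^sup>2"
    using second_moment_product[OF R R] by (simp add: power2_eq_square)
  also have "\<dots> \<le> product_const n *
      (product_const n ^ card A * (\<Prod>i\<in>A. fact (k i) * (tensor_norm (k i) (f i))\<^sup>2))\<^sup>2"
    by (intro mult_left_mono power_mono bound product_const_nonneg L_square_nonneg[OF R])
  finally show "expectation (\<lambda>\<omega>. (Y \<omega>)\<^sup>2) \<le> product_const n *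
      (product_const n ^ card A * (\<Prod>i\<in>A. fact (k i) * (tensor_norm (k i) (f i))\<^sup>2))\<^sup>2"
    unfolding EY2 .
  have "(\<Prod>i\<in>A. fact (k i) * hs_sum (k i) (f i) B) =
      (\<Prod>i\<in>A. deriv_pairing B (\<lambda>p. p 0) (k i) (F i) (F i))"
    by (simp add: F(4))
  also have "\<dots> \<le> deriv_pairing B (\<lambda>p. p 0) n R R"
    unfolding R_def n_def using F(1) by (rule bombieri_inequality_prod[OF finite_B A])
  also have "\<dots> \<le> expectation Y"
    unfolding EY by (rule fischer_le_second_moment[OF R])
  finally show "(\<Prod>i\<in>A. fact (k i) * hs_sum (k i) (f i) B) \<le> expectation Y" .
  show "expectation Y = fact (k i) * hs_sum (k i) (f i) B" if "A = {i}"
    using that F(3)[of i] by (simp add: EY R_def)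
qed

end

section \<open>Passing to the limit\<close>

text \<open>
  A sequence bounded in \<open>L\<^sup>2\<close> is uniformly integrable. Concretely, truncating at height \<open>T\<close> changes
  each mean by at most \<open>K / T\<close>, and the means of the truncated variables converge by dominated
  convergence.
\<close>

lemma (in prob_space) expectation_tendsto_of_bounded_second_moments:
  fixes Y :: "nat \<Rightarrow> 'a \<Rightarrow> real"
  assumes int: "\<And>n. integrable M (Y n)" "\<And>n. integrable M (\<lambda>\<omega>. (Y n \<omega>)\<^sup>2)"
    and K: "\<And>n. expectation (\<lambda>\<omega>. (Y n \<omega>)\<^sup>2) \<le> K"
    and nonneg: "\<And>n \<omega>. 0 \<le> Y n \<omega>" "\<And>\<omega>. 0 \<le> Z \<omega>"
    and Z [measurable]: "Z \<in> borel_measurable M"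
    and lim: "AE \<omega> in M. (\<lambda>n. Y n \<omega>) \<longlonglongrightarrow> Z \<omega>"
  shows "(\<lambda>n. expectation (Y n)) \<longlonglongrightarrow> expectation Z"
proof -
  have [measurable]: "Y n \<in> borel_measurable M" for n
    using int(1) by (rule borel_measurable_integrable)
  define E where "E T = expectation (\<lambda>\<omega>. min (Z \<omega>) T)" for T :: real
  have int_minY: "integrable M (\<lambda>\<omega>. min (Y n \<omega>) T)" if "0 \<le> T" for n T
    by (rule integrable_const_bound[where B = T]) (use that nonneg in \<open>auto simp: abs_of_nonneg\<close>)
  have int_minZ: "integrable M (\<lambda>\<omega>. min (Z \<omega>) T)" if "0 \<le> T" for T
    by (rule integrable_const_bound[where B = T]) (use that nonneg in \<open>auto simp: abs_of_nonneg\<close>)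
  have lim_min: "(\<lambda>n. expectation (\<lambda>\<omega>. min (Y n \<omega>) T)) \<longlonglongrightarrow> E T" if T: "0 \<le> T" for T
    unfolding E_def
  proof (rule integral_dominated_convergence[where w = "\<lambda>_. T"])
    show "AE \<omega> in M. (\<lambda>n. min (Y n \<omega>) T) \<longlonglongrightarrow> min (Z \<omega>) T"
      using lim by eventually_elim (intro tendsto_min tendsto_const)
    show "AE \<omega> in M. norm (min (Y n \<omega>) T) \<le> T" for n
      using T nonneg by (auto simp: abs_of_nonneg)
  qed auto
  have upper: "expectation (\<lambda>\<omega>. min (Y n \<omega>) T) \<le> expectation (Y n)" if "0 \<le> T" for n T
    by (intro integral_mono int int_minY that) auto
  have lower: "expectation (Y n) \<le> expectation (\<lambda>\<omega>. min (Y n \<omega>) T) + K / T" if T: "0 < T" for n T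
  proof -
    have *: "y \<le> min y T + y\<^sup>2 / T" if "0 \<le> y" for y
    proof (cases "y \<le> T")
      case False
      then have "T * y \<le> y * y" using that by (intro mult_right_mono) auto
      then have "y \<le> y\<^sup>2 / T" using T by (simp add: field_simps power2_eq_square)
      then show ?thesis using False T by simp
    qed (use T in auto)
    have "expectation (Y n) \<le> expectation (\<lambda>\<omega>. min (Y n \<omega>) T + (Y n \<omega>)\<^sup>2 / T)"
      using * nonneg int_minY[of T n] int(2)[of n] T by (intro integral_mono int(1)) auto
    also have "\<dots> = expectation (\<lambda>\<omega>. min (Y n \<omega>) T) + expectation (\<lambda>\<omega>. (Y n \<omega>)\<^sup>2) / T"
      using int_minY[of T n] T int(2)[of n] by simp
    also have "\<dots> \<le> expectation (\<lambda>\<omega>. min (Y n \<omega>) T) + K / T"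
      using K[of n] T by (simp add: divide_right_mono)
    finally show ?thesis .
  qed
  have E_mono: "E S \<le> E T" if "0 \<le> S" "S \<le> T" for S T
    unfolding E_def using that by (intro integral_mono int_minZ) auto
  have E_diff: "E T \<le> E S + K / S" if "0 < S" "0 \<le> T" for S T
  proof (rule LIMSEQ_le)
    show "(\<lambda>n. expectation (\<lambda>\<omega>. min (Y n \<omega>) T)) \<longlonglongrightarrow> E T" by (rule lim_min[OF that(2)])
    show "(\<lambda>n. expectation (\<lambda>\<omega>. min (Y n \<omega>) S) + K / S) \<longlonglongrightarrow> E S + K / S"
      using that by (intro tendsto_add lim_min tendsto_const) auto
    show "\<exists>N. \<forall>n\<ge>N. expectation (\<lambda>\<omega>. min (Y n \<omega>) T) \<le> expectation (\<lambda>\<omega>. min (Y n \<omega>) S) + K / S"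
      using upper[OF that(2)] lower[OF that(1)] order_trans by blast
  qed
  have inc: "incseq (\<lambda>n. E (real n))" using E_mono by (auto simp: incseq_def)
  have "E (real n) \<le> E 1 + K / 1" for n by (rule E_diff) auto
  then obtain x where x: "(\<lambda>n. E (real n)) \<longlonglongrightarrow> x" "\<And>n. E (real n) \<le> x"
    using incseq_convergent[OF inc] by metis
  have EZ: "expectation Z = x"
  proof (rule integral_monotone_convergence)
    show "(\<lambda>n. expectation (\<lambda>\<omega>. min (Z \<omega>) (real n))) \<longlonglongrightarrow> x"
      using x(1) by (simp add: E_def)
    show "AE \<omega> in M. mono (\<lambda>n. min (Z \<omega>) (real n))" by (auto simp: mono_def)
    show "AE \<omega> in M. (\<lambda>n. min (Z \<omega>) (real n)) \<longlonglongrightarrow> Z \<omega>"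
    proof (rule AE_I2)
      fix \<omega>
      have "\<forall>\<^sub>F n in sequentially. min (Z \<omega>) (real n) = Z \<omega>"
        using eventually_ge_at_top[of "nat \<lceil>Z \<omega>\<rceil>"] by eventually_elim linarith
      then show "(\<lambda>n. min (Z \<omega>) (real n)) \<longlonglongrightarrow> Z \<omega>" by (rule tendsto_eventually)
    qed
  qed (auto intro: int_minZ)
  show ?thesis unfolding EZ
  proof (rule LIMSEQ_I)
    fix r :: real assume r: "0 < r"
    have "(\<lambda>m. K / real m) \<longlonglongrightarrow> 0" by (rule lim_const_over_n)
    then have "\<forall>\<^sub>F m in sequentially. K / real m < r / 2" using r by (auto dest: order_tendstoD(2)[of _ 0 _ "r / 2"])
    moreover have "\<forall>\<^sub>F m in sequentially. 0 < m" by (rule eventually_gt_at_top)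
    ultimately have "\<forall>\<^sub>F m in sequentially. K / real m < r / 2 \<and> 0 < m" by eventually_elim auto
    then obtain m where m: "K / real m < r / 2" "0 < m" by (auto simp: eventually_sequentially)
    obtain N where N: "\<And>n. n \<ge> N \<Longrightarrow> \<bar>expectation (\<lambda>\<omega>. min (Y n \<omega>) (real m)) - E (real m)\<bar> < r / 2"
      using LIMSEQ_D[OF lim_min[of "real m"], of "r / 2"] r by auto
    have "x \<le> E (real m) + K / real m"
      using x(1) by (rule LIMSEQ_le_const2) (use E_diff[of "real m"] m(2) in auto)
    have "\<bar>expectation (Y n) - x\<bar> < r" if "n \<ge> N" for n
    proof -
      have "expectation (\<lambda>\<omega>. min (Y n \<omega>) (real m)) \<le> expectation (Y n)"
        "expectation (Y n) \<le> expectation (\<lambda>\<omega>. min (Y n \<omega>) (real m)) + K / real m"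
        using upper lower m(2) by auto
      then show ?thesis
        using N[OF that] x(2)[of m] m(1) \<open>x \<le> E (real m) + K / real m\<close> unfolding abs_less_iff by linarith
    qed
    then show "\<exists>N. \<forall>n\<ge>N. norm (expectation (Y n) - x) < r" by auto
  qed
qed

text \<open>
  Approximating sets for the individual tensors exist because the norm is a supremum; an orthonormal
  set whose span contains all of them serves every tensor, by monotonicity.
\<close>

lemma common_approximating_basis:
  fixes f :: "'i \<Rightarrow> 'h::{real_inner, complete_space} tensor"
  assumes "finite A" and f: "\<And>i. i \<in> A \<Longrightarrow> f i \<in> tensor_space (k i)" and e: "0 < e"
  shows "\<exists>B. finite_orthonormal B \<and> (\<forall>i\<in>A. (tensor_norm (k i) (f i))\<^sup>2 - e < hs_sum (k i) (f i) B)"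
proof -
  have "\<exists>B. finite_orthonormal B \<and> (tensor_norm (k i) (f i))\<^sup>2 - e < hs_sum (k i) (f i) B" if i: "i \<in> A" for i
  proof -
    have "finite_orthonormal ({} :: 'h set)" by (simp add: finite_orthonormal_def)
    then have ne: "Collect finite_orthonormal \<noteq> ({} :: 'h set set)" by auto
    have bdd: "bdd_above (hs_sum (k i) (f i) ` Collect finite_orthonormal)"
      using f[OF i] by (simp add: tensor_space_def)
    have "(tensor_norm (k i) (f i))\<^sup>2 - e < (SUP B \<in> Collect finite_orthonormal. hs_sum (k i) (f i) B)"
      using e tensor_norm_square(1)[OF f[OF i]] by simp
    then show ?thesis using less_cSUP_iff[OF ne bdd] by auto
  qed
  then obtain B where B: "\<And>i. i \<in> A \<Longrightarrow> finite_orthonormal (B i)"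
    "\<And>i. i \<in> A \<Longrightarrow> (tensor_norm (k i) (f i))\<^sup>2 - e < hs_sum (k i) (f i) (B i)" by metis
  have "finite (\<Union>i\<in>A. B i)" using assms(1) B(1) finite_orthonormalD(1) by blast
  then obtain B' where B': "finite_orthonormal B'" "\<And>c. c \<in> (\<Union>i\<in>A. B i) \<Longrightarrow> onb_proj B' c = c"
    using gram_schmidt_extension[of "\<Union>i\<in>A. B i" "{}"] by (auto simp: finite_orthonormal_def)
  have "(tensor_norm (k i) (f i))\<^sup>2 - e < hs_sum (k i) (f i) B'" if i: "i \<in> A" for i
  proof -
    have "hs_sum (k i) (f i) (B i) \<le> hs_sum (k i) (f i) B'"
      using f[OF i] i by (intro hs_sum_mono B B') (auto simp: tensor_space_def)
    then show ?thesis using B(2)[OF i] by simp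
  qed
  then show ?thesis using B'(1) by blast
qed

context isonormal_gaussian_process
begin

lemma multiple_integral_second_moment_tendsto_0:
  assumes I: "multiple_integral M X k I" and g: "\<And>n. g n \<in> sym_tensor_space k"
    and lim: "(\<lambda>n. (tensor_norm k (g n))\<^sup>2) \<longlonglongrightarrow> 0"
  shows "(\<lambda>n. expectation (\<lambda>\<omega>. (I (g n) \<omega>)\<^sup>2)) \<longlonglongrightarrow> 0"
proof -
  obtain C where C: "\<And>f. f \<in> sym_tensor_space k \<Longrightarrow> expectation (\<lambda>\<omega>. (I f \<omega>)\<^sup>2) \<le> C * (tensor_norm k f)\<^sup>2"
    using I unfolding multiple_integral_def by blast
  show ?thesis
  proof (rule tendsto_sandwich)
    show "\<forall>\<^sub>F n in sequentially. 0 \<le> expectation (\<lambda>\<omega>. (I (g n) \<omega>)\<^sup>2)" by simp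
    show "\<forall>\<^sub>F n in sequentially. expectation (\<lambda>\<omega>. (I (g n) \<omega>)\<^sup>2) \<le> C * (tensor_norm k (g n))\<^sup>2"
      using C g by simp
    show "(\<lambda>n. C * (tensor_norm k (g n))\<^sup>2) \<longlonglongrightarrow> 0"
      using tendsto_mult_right_zero[OF lim] by simp
  qed simp
qed

text \<open>
  The multiple integrals of the compressions converge in \<open>L\<^sup>2\<close>, hence almost surely along a common
  subsequence. The means of their products converge because the fourth moments of the products are
  bounded independently of the approximating sets.
\<close>

lemma finite_rank_approximation:
  fixes J :: "'i \<Rightarrow> 'h tensor \<Rightarrow> 'a \<Rightarrow> real"
  assumes A: "finite A" and I: "\<And>i. i \<in> A \<Longrightarrow> multiple_integral M X (k i) (J i)"
    and k: "\<And>i. i \<in> A \<Longrightarrow> 1 \<le> k i" and f: "\<And>i. i \<in> A \<Longrightarrow> f i \<in> sym_tensor_space (k i)"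
  obtains B where "\<And>n. finite_orthonormal (B n)"
    "\<And>i. i \<in> A \<Longrightarrow> (\<lambda>n. hs_sum (k i) (f i) (B n)) \<longlonglongrightarrow> (tensor_norm (k i) (f i))\<^sup>2"
    "(\<lambda>n. expectation (\<lambda>\<omega>. \<Prod>i\<in>A. (J i (tproj (B n) (f i)) \<omega>)\<^sup>2)) \<longlonglongrightarrow>
      expectation (\<lambda>\<omega>. \<Prod>i\<in>A. (J i (f i) \<omega>)\<^sup>2)"
proof -
  have ft: "f i \<in> tensor_space (k i)" if "i \<in> A" for i
    using f[OF that] by (simp add: sym_tensor_space_def)
  have "\<exists>B. finite_orthonormal B \<and>
    (\<forall>i\<in>A. (tensor_norm (k i) (f i))\<^sup>2 - 1 / real (Suc n) < hs_sum (k i) (f i) B)" for n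
    by (rule common_approximating_basis[OF A ft]) auto
  then obtain B where B: "\<And>n. finite_orthonormal (B n)"
    and Bhs: "\<And>n i. i \<in> A \<Longrightarrow> (tensor_norm (k i) (f i))\<^sup>2 - 1 / real (Suc n) < hs_sum (k i) (f i) (B n)"
    by metis
  have hs_lim: "(\<lambda>n. hs_sum (k i) (f i) (B n)) \<longlonglongrightarrow> (tensor_norm (k i) (f i))\<^sup>2" if i: "i \<in> A" for i
  proof (rule tendsto_sandwich)
    show "\<forall>\<^sub>F n in sequentially. (tensor_norm (k i) (f i))\<^sup>2 - 1 / real (Suc n) \<le> hs_sum (k i) (f i) (B n)"
      using Bhs[OF i] by (simp add: less_imp_le)
    show "\<forall>\<^sub>F n in sequentially. hs_sum (k i) (f i) (B n) \<le> (tensor_norm (k i) (f i))\<^sup>2"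
      using tensor_norm_square(2)[OF ft[OF i] B] by simp
    have "(\<lambda>n. (tensor_norm (k i) (f i))\<^sup>2 - 1 / real (Suc n)) \<longlonglongrightarrow> (tensor_norm (k i) (f i))\<^sup>2 - 0"
      by (intro tendsto_diff tendsto_const) (use LIMSEQ_inverse_real_of_nat in \<open>simp add: inverse_eq_divide\<close>)
    then show "(\<lambda>n. (tensor_norm (k i) (f i))\<^sup>2 - 1 / real (Suc n)) \<longlonglongrightarrow> (tensor_norm (k i) (f i))\<^sup>2"
      by simp
  qed simp
  define D where "D n i = (\<lambda>xs. f i xs - tproj (B n) (f i) xs)" for n i
  have tp: "tproj (B n) (f i) \<in> sym_tensor_space (k i)" if "i \<in> A" for n i
    by (rule tproj_in_sym_tensor_space[OF f[OF that] finite_orthonormalD(1)[OF B]])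
  have D: "D n i \<in> sym_tensor_space (k i)" if "i \<in> A" for n i
    using sym_tensor_lincomb[OF f[OF that] tp[OF that, of n], of 1 "-1"] by (simp add: D_def)
  have JD: "AE \<omega> in M. J i (D n i) \<omega> = J i (f i) \<omega> - J i (tproj (B n) (f i)) \<omega>" if "i \<in> A" for n i
  proof -
    have "AE \<omega> in M. J i (\<lambda>xs. 1 * f i xs + (-1) * tproj (B n) (f i) xs) \<omega> =
        1 * J i (f i) \<omega> + (-1) * J i (tproj (B n) (f i)) \<omega>"
      using I[OF that] f[OF that] tp[OF that] unfolding multiple_integral_def by blast
    then show ?thesis by (simp add: D_def)
  qed
  have sq_int: "integrable M (\<lambda>\<omega>. (J i g \<omega>)\<^sup>2)" and meas: "J i g \<in> borel_measurable M"
    if "i \<in> A" "g \<in> sym_tensor_space (k i)" for i g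
    using I[OF that(1)] that(2) unfolding multiple_integral_def by blast+
  have D0: "(\<lambda>n. expectation (\<lambda>\<omega>. (J i (D n i) \<omega>)\<^sup>2)) \<longlonglongrightarrow> 0" if i: "i \<in> A" for i
  proof (rule multiple_integral_second_moment_tendsto_0[OF I[OF i] D[OF i]])
    have "(\<lambda>n. (tensor_norm (k i) (f i))\<^sup>2 - hs_sum (k i) (f i) (B n)) \<longlonglongrightarrow>
        (tensor_norm (k i) (f i))\<^sup>2 - (tensor_norm (k i) (f i))\<^sup>2"
      by (intro tendsto_diff tendsto_const hs_lim i)
    then have lim: "(\<lambda>n. (tensor_norm (k i) (f i))\<^sup>2 - hs_sum (k i) (f i) (B n)) \<longlonglongrightarrow> 0" by simp
    have "(tensor_norm (k i) (D n i))\<^sup>2 \<le> (tensor_norm (k i) (f i))\<^sup>2 - hs_sum (k i) (f i) (B n)" for n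
      unfolding D_def using D[OF i, of n]
      by (intro tensor_norm_diff_tproj ft B i) (simp add: D_def sym_tensor_space_def)
    then show "(\<lambda>n. (tensor_norm (k i) (D n i))\<^sup>2) \<longlonglongrightarrow> 0"
      by (intro tendsto_sandwich[OF _ _ tendsto_const lim]) auto
  qed
  \<comment> \<open>a single sequence that dominates the errors of all indices, so that one subsequence serves all\<close>
  define G where "G n = (\<lambda>\<omega>. \<Sum>i\<in>A. (J i (D n i) \<omega>)\<^sup>2)" for n
  have G_int: "integrable M (G n)" for n
    unfolding G_def by (intro Bochner_Integration.integrable_sum sq_int D)
  have "(\<lambda>n. \<Sum>i\<in>A. expectation (\<lambda>\<omega>. (J i (D n i) \<omega>)\<^sup>2)) \<longlonglongrightarrow> 0"
    using tendsto_sum[of A "\<lambda>i n. expectation (\<lambda>\<omega>. (J i (D n i) \<omega>)\<^sup>2)" "\<lambda>_. 0"] D0 by simp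
  moreover have "expectation (\<lambda>\<omega>. norm (G n \<omega>)) = (\<Sum>i\<in>A. expectation (\<lambda>\<omega>. (J i (D n i) \<omega>)\<^sup>2))" for n
  proof -
    have "norm (G n \<omega>) = (\<Sum>i\<in>A. (J i (D n i) \<omega>)\<^sup>2)" for \<omega>
      by (simp add: G_def sum_nonneg)
    then show ?thesis using D by (subst Bochner_Integration.integral_sum[symmetric]) (auto intro: sq_int)
  qed
  ultimately have "(\<lambda>n. expectation (\<lambda>\<omega>. norm (G n \<omega>))) \<longlonglongrightarrow> 0" by simp
  from tendsto_L1_AE_subseq[OF G_int this]
  obtain r where r: "strict_mono r" "AE \<omega> in M. (\<lambda>n. G (r n) \<omega>) \<longlonglongrightarrow> 0" by auto
  have "AE \<omega> in M. \<forall>n. \<forall>i\<in>A. J i (D n i) \<omega> = J i (f i) \<omega> - J i (tproj (B n) (f i)) \<omega>"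
    unfolding AE_all_countable by (intro allI AE_finite_allI[OF A] JD)
  then have conv: "AE \<omega> in M. (\<lambda>n. \<Prod>i\<in>A. (J i (tproj (B (r n)) (f i)) \<omega>)\<^sup>2) \<longlonglongrightarrow> (\<Prod>i\<in>A. (J i (f i) \<omega>)\<^sup>2)"
    using r(2)
  proof eventually_elim
    case (elim \<omega>)
    have "(\<lambda>n. J i (tproj (B (r n)) (f i)) \<omega>) \<longlonglongrightarrow> J i (f i) \<omega>" if i: "i \<in> A" for i
    proof -
      have le: "(J i (D (r n) i) \<omega>)\<^sup>2 \<le> G (r n) \<omega>" for n
        unfolding G_def using i by (intro member_le_sum A) auto
      have "(\<lambda>n. (J i (D (r n) i) \<omega>)\<^sup>2) \<longlonglongrightarrow> 0"
        by (rule tendsto_sandwich[OF _ _ tendsto_const elim(2)]) (use le in auto)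
      then have "(\<lambda>n. J i (D (r n) i) \<omega>) \<longlonglongrightarrow> 0"
        using tendsto_null_power[of "\<lambda>n. J i (D (r n) i) \<omega>"] by (simp add: tendsto_power_zero power_tendsto_0_iff)
      then have "(\<lambda>n. J i (f i) \<omega> - J i (D (r n) i) \<omega>) \<longlonglongrightarrow> J i (f i) \<omega> - 0"
        by (intro tendsto_diff tendsto_const)
      then show ?thesis using elim(1) i by simp
    qed
    then show ?case by (intro tendsto_prod tendsto_power)
  qed
  define K where "K = product_const (\<Sum>i\<in>A. k i) *
      (product_const (\<Sum>i\<in>A. k i) ^ card A * (\<Prod>i\<in>A. fact (k i) * (tensor_norm (k i) (f i))\<^sup>2))\<^sup>2"
  have "(\<lambda>n. expectation (\<lambda>\<omega>. \<Prod>i\<in>A. (J i (tproj (B (r n)) (f i)) \<omega>)\<^sup>2)) \<longlonglongrightarrow>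
      expectation (\<lambda>\<omega>. \<Prod>i\<in>A. (J i (f i) \<omega>)\<^sup>2)"
  proof (rule expectation_tendsto_of_bounded_second_moments[where K = K])
    show "expectation (\<lambda>\<omega>. (\<Prod>i\<in>A. (J i (tproj (B (r n)) (f i)) \<omega>)\<^sup>2)\<^sup>2) \<le> K" for n
      unfolding K_def by (rule finite_rank_product(3)[OF A I k f B])
    show "(\<lambda>\<omega>. \<Prod>i\<in>A. (J i (f i) \<omega>)\<^sup>2) \<in> borel_measurable M"
      using meas f by (intro borel_measurable_prod borel_measurable_power) auto
  qed (auto intro!: finite_rank_product(1,2)[OF A I k f B] conv prod_nonneg)
  moreover have "(\<lambda>n. hs_sum (k i) (f i) (B (r n))) \<longlonglongrightarrow> (tensor_norm (k i) (f i))\<^sup>2" if "i \<in> A" for i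
    using LIMSEQ_subseq_LIMSEQ[OF hs_lim[OF that] r(1)] by (simp add: o_def)
  ultimately show thesis using that[of "\<lambda>n. B (r n)"] B by blast
qed

text \<open>
  In finite rank the second moment of a single multiple integral is known exactly, and both sides of
  the formula pass to the limit.
\<close>

lemma multiple_integral_isometry:
  assumes I: "multiple_integral M X k I" and k: "1 \<le> k" and f: "f \<in> sym_tensor_space k"
  shows "expectation (\<lambda>\<omega>. (I f \<omega>)\<^sup>2) = fact k * (tensor_norm k f)\<^sup>2"
proof -
  obtain B where B: "\<And>n. finite_orthonormal (B n)"
    "\<And>i. i \<in> {()} \<Longrightarrow> (\<lambda>n. hs_sum k f (B n)) \<longlonglongrightarrow> (tensor_norm k f)\<^sup>2"
    "(\<lambda>n. expectation (\<lambda>\<omega>. \<Prod>i\<in>{()}. (I (tproj (B n) f) \<omega>)\<^sup>2)) \<longlonglongrightarrow>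
      expectation (\<lambda>\<omega>. \<Prod>i\<in>{()}. (I f \<omega>)\<^sup>2)"
    by (rule finite_rank_approximation[of "{()}" "\<lambda>_. k" "\<lambda>_. I" "\<lambda>_. f"]) (use I k f in auto)
  have "expectation (\<lambda>\<omega>. (I (tproj (B n) f) \<omega>)\<^sup>2) = fact k * hs_sum k f (B n)" for n
    using finite_rank_product(5)[of "{()}" "\<lambda>_. k" "\<lambda>_. I" "\<lambda>_. f" "B n" "()"] I k f B(1) by simp
  then have "(\<lambda>n. fact k * hs_sum k f (B n)) \<longlonglongrightarrow> expectation (\<lambda>\<omega>. (I f \<omega>)\<^sup>2)"
    using B(3) by simp
  moreover have "(\<lambda>n. fact k * hs_sum k f (B n)) \<longlonglongrightarrow> fact k * (tensor_norm k f)\<^sup>2"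
    using B(2) by (intro tendsto_mult tendsto_const) auto
  ultimately show ?thesis by (rule LIMSEQ_unique)
qed

lemma multiple_integral_product_inequality:
  fixes J :: "'i \<Rightarrow> 'h tensor \<Rightarrow> 'a \<Rightarrow> real"
  assumes A: "finite A" and I: "\<And>i. i \<in> A \<Longrightarrow> multiple_integral M X (k i) (J i)"
    and k: "\<And>i. i \<in> A \<Longrightarrow> 1 \<le> k i" and f: "\<And>i. i \<in> A \<Longrightarrow> f i \<in> sym_tensor_space (k i)"
  shows "(\<Prod>i\<in>A. fact (k i) * (tensor_norm (k i) (f i))\<^sup>2) \<le> expectation (\<lambda>\<omega>. \<Prod>i\<in>A. (J i (f i) \<omega>)\<^sup>2)"
proof -
  obtain B where B: "\<And>n. finite_orthonormal (B n)"
    "\<And>i. i \<in> A \<Longrightarrow> (\<lambda>n. hs_sum (k i) (f i) (B n)) \<longlonglongrightarrow> (tensor_norm (k i) (f i))\<^sup>2"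
    "(\<lambda>n. expectation (\<lambda>\<omega>. \<Prod>i\<in>A. (J i (tproj (B n) (f i)) \<omega>)\<^sup>2)) \<longlonglongrightarrow>
      expectation (\<lambda>\<omega>. \<Prod>i\<in>A. (J i (f i) \<omega>)\<^sup>2)"
    by (rule finite_rank_approximation[OF A I k f]) blast+
  have "(\<lambda>n. \<Prod>i\<in>A. fact (k i) * hs_sum (k i) (f i) (B n)) \<longlonglongrightarrow>
      (\<Prod>i\<in>A. fact (k i) * (tensor_norm (k i) (f i))\<^sup>2)"
    by (intro tendsto_prod tendsto_mult tendsto_const B(2))
  then show ?thesis
    by (rule LIMSEQ_le[OF _ B(3)]) (intro exI[of _ 0] allI impI finite_rank_product(4) A I k f B(1))
qed

end

theorem theorem1p6:
  fixes M :: "'a measure"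
    and X :: "'h::{real_inner, complete_space} \<Rightarrow> 'a \<Rightarrow> real"
    and I :: "nat \<Rightarrow> 'h tensor \<Rightarrow> 'a \<Rightarrow> real"
    and d :: nat and k :: "nat \<Rightarrow> nat" and f :: "nat \<Rightarrow> 'h tensor"
  assumes "separable_space (euclidean :: 'h topology)"
    and "isonormal_gaussian_process M X"
    and "\<And>n. n \<ge> 1 \<Longrightarrow> multiple_integral M X n (I n)"
    and "d \<ge> 2"
    and "\<And>i. i \<in> {1..d} \<Longrightarrow> k i \<ge> 1"
    and "\<And>i. i \<in> {1..d} \<Longrightarrow> f i \<in> sym_tensor_space (k i)"
  shows "(\<integral>\<omega>. (\<Prod>i=1..d. (I (k i) (f i) \<omega>)\<^sup>2) \<partial>M) \<ge> (\<Prod>i=1..d. \<integral>\<omega>. (I (k i) (f i) \<omega>)\<^sup>2 \<partial>M)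
    \<and> (\<Prod>i=1..d. \<integral>\<omega>. (I (k i) (f i) \<omega>)\<^sup>2 \<partial>M) =
      (\<Prod>i=1..d. fact (k i) * (tensor_norm (k i) (f i))\<^sup>2)"
proof -
  interpret isonormal_gaussian_process M X by fact
  have I: "multiple_integral M X (k i) (I (k i))" if "i \<in> {1..d}" for i
    using assms(3) assms(5)[OF that] .
  have eq: "(\<Prod>i=1..d. \<integral>\<omega>. (I (k i) (f i) \<omega>)\<^sup>2 \<partial>M) = (\<Prod>i=1..d. fact (k i) * (tensor_norm (k i) (f i))\<^sup>2)"
    by (intro prod.cong refl multiple_integral_isometry I assms(5,6))
  have "(\<Prod>i=1..d. fact (k i) * (tensor_norm (k i) (f i))\<^sup>2) \<le> (\<integral>\<omega>. (\<Prod>i=1..d. (I (k i) (f i) \<omega>)\<^sup>2) \<partial>M)"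
    by (intro multiple_integral_product_inequality[where J = "\<lambda>i. I (k i)" and k = k and f = f]
        finite_atLeastAtMost I assms(5,6))
  with eq show ?thesis by simp
qed

end
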